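(* Let $G$ be a non-abelian infinite supersoluble group. Then every non-abelian subgroup $H$ of $G$ satisfies $C_G(H)\le H$ if and only if the following holds: $G=A\langle x\rangle$, where $x$ has order $2^n$ for some $n$, $A=\langle a_1\rangle\times\dots\times\langle a_t\rangle\times\langle d\rangle$ is an abelian subgroup with each $a_i$ of infinite or odd order, $d$ has order $2^h$ for some $h\ge 0$ (and $d^{2^{h-1}}=x^{2^{n-1}}$ if $h>0$), and $a^x=a^{-1}$ for all $a\in A$.
   Context: A group is supersoluble if it has a normal series (each term normal in the whole group) with cyclic factors. $C_G(H)$ denotes the centralizer of $H$ in $G$; $a^x=x^{-1}ax$. *)

theory Defs
  imports "HOL-Algebra.Algebra"
begin

definition supersoluble :: "('a, 'b) monoid_scheme \<Rightarrow> bool" where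
  "supersoluble G \<longleftrightarrow> (\<exists>Hs :: 'a set list. Hs \<noteq> [] \<and> hd Hs = carrier G \<and> last Hs = {\<one>\<^bsub>G\<^esub>} \<and>
      (\<forall>i < length Hs. Hs ! i \<lhd> G) \<and>
      (\<forall>i. Suc i < length Hs \<longrightarrow> Hs ! Suc i \<subseteq> Hs ! i \<and>
           cyclic_group ((G\<lparr>carrier := Hs ! i\<rparr>) Mod (Hs ! Suc i))))"

definition centralizer :: "('a, 'b) monoid_scheme \<Rightarrow> 'a set \<Rightarrow> 'a set" where
  "centralizer G H = {g \<in> carrier G. \<forall>h \<in> H. g \<otimes>\<^bsub>G\<^esub> h = h \<otimes>\<^bsub>G\<^esub> g}"

definition conj :: "('a, 'b) monoid_scheme \<Rightarrow> 'a \<Rightarrow> 'a \<Rightarrow> 'a" where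
  "conj G a x = inv\<^bsub>G\<^esub> x \<otimes>\<^bsub>G\<^esub> a \<otimes>\<^bsub>G\<^esub> x"

definition cyclic_direct_product :: "('a, 'b) monoid_scheme \<Rightarrow> 'a set \<Rightarrow> 'a list \<Rightarrow> bool" where
  "cyclic_direct_product G A gs \<longleftrightarrow>
     set gs \<subseteq> carrier G \<and>
     A = generate G (set gs) \<and>
     (\<forall>u \<in> set gs. \<forall>v \<in> set gs. u \<otimes>\<^bsub>G\<^esub> v = v \<otimes>\<^bsub>G\<^esub> u) \<and>
     (\<forall>ys. length ys = length gs \<longrightarrow>
         (\<forall>i < length gs. ys ! i \<in> generate G {gs ! i}) \<longrightarrow>
         foldr (\<otimes>\<^bsub>G\<^esub>) ys \<one>\<^bsub>G\<^esub> = \<one>\<^bsub>G\<^esub> \<longrightarrow>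
         (\<forall>i < length ys. ys ! i = \<one>\<^bsub>G\<^esub>))"

end

theory Submission
  imports Defs
begin

text \<open>
  Suppose that non-abelian subgroups contain their centralizers. The key point is that an element
  \<open>w\<close> of infinite order has abelian centralizer \<open>C\<close>. Otherwise supersolubility yields a non-central
  \<open>b \<in> C\<close> generating a normal subgroup of \<open>C\<close> modulo a central one, and \<open>y \<in> C\<close> with
  \<open>c = [b, y] \<noteq> 1\<close>. The element \<open>w\<close> lies in every non-abelian \<open>\<langle>b', y'\<rangle>\<close> with \<open>b' \<in> \<langle>b\<rangle>\<close> and \<open>y' \<in> \<langle>y\<rangle>\<close>;
  the normal form \<open>b^i c^j y^l\<close> shows that this makes a power of \<open>w\<close> divisible by infinitely many
  integers in a 2-generated abelian group, which is absurd.

  An infinite supersoluble group has an infinite cyclic normal subgroup \<open>\<langle>z\<rangle>\<close>. So \<open>C = C_G(z)\<close> is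
  abelian of index 2, the centre of \<open>G\<close> is finite, and it equals \<open>\<langle>g^2\<rangle>\<close> for every \<open>g \<notin> C\<close>. Choosing
  \<open>x \<notin> C\<close> of 2-power order, \<open>c c^x \<in> \<langle>x^4\<rangle>\<close> for all \<open>c \<in> C\<close>, so \<open>C\<close> is generated by \<open>x^2\<close> and the
  subgroup \<open>A\<close> of elements inverted by \<open>x\<close>. Involutions of \<open>A\<close> are central, hence there is at most
  one, and the basis theorem gives the decomposition of \<open>A\<close>.

  Conversely, if \<open>G = A\<langle>x\<rangle>\<close> is as described, a non-abelian \<open>H\<close> contains some \<open>a x^k\<close> with \<open>k\<close> odd, whose
  square generates \<open>\<langle>x^2\<rangle>\<close>; and an element centralizing \<open>H\<close> is an element of \<open>A\<close> of order at most 2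
  times a power of \<open>x^2\<close>.
\<close>

section \<open>Conjugation and commuting elements\<close>

context group
begin

lemma conj_closed [simp, intro]:
  "a \<in> carrier G \<Longrightarrow> x \<in> carrier G \<Longrightarrow> conj G a x \<in> carrier G"
  by (simp add: conj_def)

lemma conj_mult:
  "\<lbrakk>a \<in> carrier G; b \<in> carrier G; x \<in> carrier G\<rbrakk> \<Longrightarrow> conj G (a \<otimes> b) x = conj G a x \<otimes> conj G b x"
  by (simp add: conj_def m_assoc) (simp add: m_assoc [symmetric])

lemma conj_conj:
  "\<lbrakk>a \<in> carrier G; x \<in> carrier G; y \<in> carrier G\<rbrakk> \<Longrightarrow> conj G (conj G a x) y = conj G a (x \<otimes> y)"
  by (simp add: conj_def m_assoc inv_mult_group)

lemma conj_one_right [simp]: "a \<in> carrier G \<Longrightarrow> conj G a \<one> = a"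
  by (simp add: conj_def)

lemma conj_conj_inv [simp]:
  "\<lbrakk>a \<in> carrier G; x \<in> carrier G\<rbrakk> \<Longrightarrow> conj G (conj G a x) (inv x) = a"
  "\<lbrakk>a \<in> carrier G; x \<in> carrier G\<rbrakk> \<Longrightarrow> conj G (conj G a (inv x)) x = a"
  by (simp_all add: conj_conj)

lemma conj_hom: "x \<in> carrier G \<Longrightarrow> (\<lambda>a. conj G a x) \<in> hom G G"
  by (simp add: hom_def conj_mult)

lemma conj_int_pow:
  "\<lbrakk>a \<in> carrier G; x \<in> carrier G\<rbrakk> \<Longrightarrow> conj G (a [^] (k::int)) x = conj G a x [^] k"
  using hom_int_pow[OF conj_hom, of x a k] by simp

lemma conj_inv:
  "\<lbrakk>a \<in> carrier G; x \<in> carrier G\<rbrakk> \<Longrightarrow> conj G (inv a) x = inv (conj G a x)"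
  by (simp add: conj_def inv_mult_group m_assoc)

lemma conj_eq_self_iff:
  assumes "a \<in> carrier G" "x \<in> carrier G"
  shows "conj G a x = a \<longleftrightarrow> a \<otimes> x = x \<otimes> a"
proof -
  have "conj G a x = a \<longleftrightarrow> x \<otimes> conj G a x = x \<otimes> a"
    using assms by simp
  also have "x \<otimes> conj G a x = a \<otimes> x"
    using assms by (simp add: conj_def m_assoc [symmetric])
  finally show ?thesis .
qed

lemma mult_eq_mult_conj:
  assumes "a \<in> carrier G" "x \<in> carrier G"
  shows "a \<otimes> x = x \<otimes> conj G a x" "x \<otimes> a = conj G a (inv x) \<otimes> x"
  using assms by (simp_all add: conj_def m_assoc) (simp add: m_assoc [symmetric])

text \<open>Allowing \<open>c'\<close> to differ from \<open>c\<close> covers both commuting factors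
  and factors changed by conjugation, so all products of normal forms are computed with it.\<close>

lemma mult_swap_middle:
  assumes "a \<in> carrier G" "b \<in> carrier G" "c \<in> carrier G" "c' \<in> carrier G" "d \<in> carrier G"
    and "b \<otimes> c = c' \<otimes> b"
  shows "(a \<otimes> b) \<otimes> (c \<otimes> d) = (a \<otimes> c') \<otimes> (b \<otimes> d)"
proof -
  have "(a \<otimes> b) \<otimes> (c \<otimes> d) = a \<otimes> (b \<otimes> c) \<otimes> d" using assms(1-5) by (simp add: m_assoc)
  also have "\<dots> = (a \<otimes> c') \<otimes> (b \<otimes> d)" unfolding assms(6) using assms(1-5) by (simp add: m_assoc)
  finally show ?thesis .
qed

lemma comm_mult_left:
  assumes "x \<in> carrier G" "y \<in> carrier G" "w \<in> carrier G" "x \<otimes> w = w \<otimes> x" "y \<otimes> w = w \<otimes> y"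
  shows "(x \<otimes> y) \<otimes> w = w \<otimes> (x \<otimes> y)"
proof -
  have "(x \<otimes> y) \<otimes> w = x \<otimes> w \<otimes> y" using assms(1-3,5) by (simp add: m_assoc)
  then show ?thesis using assms(1-4) by (simp add: m_assoc)
qed

lemma comm_inv_left:
  assumes "x \<in> carrier G" "w \<in> carrier G" "x \<otimes> w = w \<otimes> x"
  shows "inv x \<otimes> w = w \<otimes> inv x"
proof -
  have "conj G w x = w" using assms by (simp add: conj_eq_self_iff)
  then have "conj G w (inv x) = w" using conj_conj_inv(1)[of w x] assms by simp
  then show ?thesis using conj_eq_self_iff[of w "inv x"] assms by simp
qed

text \<open>Being a subgroup, a centralizer is closed under powers and generation;
  \<open>comm_int_pow_left\<close> and \<open>comm_generate\<close> are obtained this way.\<close>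

lemma subgroup_centralizer:
  assumes "S \<subseteq> carrier G" shows "subgroup (centralizer G S) G"
proof (rule subgroupI)
  show "centralizer G S \<subseteq> carrier G" by (auto simp: centralizer_def)
  show "centralizer G S \<noteq> {}"
    using assms by (auto simp: centralizer_def intro!: exI[of _ \<one>])
next
  fix a assume a: "a \<in> centralizer G S"
  have "inv a \<otimes> h = h \<otimes> inv a" if "h \<in> S" for h
    using that a assms by (intro comm_inv_left) (auto simp: centralizer_def)
  then show "inv a \<in> centralizer G S" using a by (auto simp: centralizer_def)
next
  fix a b assume a: "a \<in> centralizer G S" and b: "b \<in> centralizer G S"
  have "a \<otimes> b \<otimes> h = h \<otimes> (a \<otimes> b)" if "h \<in> S" for h
    using that a b assms by (intro comm_mult_left) (auto simp: centralizer_def)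
  then show "a \<otimes> b \<in> centralizer G S" using a b by (auto simp: centralizer_def)
qed

lemma comm_int_pow_left:
  assumes "x \<in> carrier G" "y \<in> carrier G" "x \<otimes> y = y \<otimes> x"
  shows "x [^] (i::int) \<otimes> y = y \<otimes> x [^] i"
proof -
  have "x \<in> centralizer G {y}" using assms by (simp add: centralizer_def)
  then have "x [^] i \<in> centralizer G {y}"
    using subgroup_int_pow_closed subgroup_centralizer[of "{y}"] assms by simp
  then show ?thesis by (simp add: centralizer_def)
qed

lemma comm_int_pow:
  assumes "x \<in> carrier G" "y \<in> carrier G" "x \<otimes> y = y \<otimes> x"
  shows "x [^] (i::int) \<otimes> y [^] (j::int) = y [^] j \<otimes> x [^] i"
  using assms comm_int_pow_left[of y "x [^] i" j] comm_int_pow_left[of x y i] by simp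

lemma comm_generate:
  assumes "S \<subseteq> carrier G" "w \<in> carrier G" "\<And>s. s \<in> S \<Longrightarrow> w \<otimes> s = s \<otimes> w" "g \<in> generate G S"
  shows "w \<otimes> g = g \<otimes> w"
proof -
  have "S \<subseteq> centralizer G {w}" using assms by (auto simp: centralizer_def)
  then have "generate G S \<subseteq> centralizer G {w}"
    using generate_subgroup_incl subgroup_centralizer assms(2) by simp
  then show ?thesis using assms(4) by (auto simp: centralizer_def)
qed

lemma comm_group_subgroup_iff:
  assumes "subgroup H G"
  shows "comm_group (G\<lparr>carrier := H\<rparr>) \<longleftrightarrow> (\<forall>u\<in>H. \<forall>v\<in>H. u \<otimes> v = v \<otimes> u)"
proof
  assume "comm_group (G\<lparr>carrier := H\<rparr>)"
  then interpret H: comm_group "G\<lparr>carrier := H\<rparr>" .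
  show "\<forall>u\<in>H. \<forall>v\<in>H. u \<otimes> v = v \<otimes> u" using H.m_comm by simp
next
  assume "\<forall>u\<in>H. \<forall>v\<in>H. u \<otimes> v = v \<otimes> u"
  then show "comm_group (G\<lparr>carrier := H\<rparr>)"
    using group.group_comm_groupI[OF subgroup.subgroup_is_group[OF assms is_group]] by simp
qed

section \<open>Normal forms in a subgroup extended by a normalizing element\<close>

text \<open>Negative powers are the reason for asking stability under \<open>inv y\<close> as well:
  an infinite \<open>T\<close> may be conjugated by \<open>y\<close> into a proper subgroup of
  itself.\<close>

lemma conj_subgroup_int_pow:
  assumes T: "subgroup T G" and y: "y \<in> carrier G"
    and n: "\<And>t. t \<in> T \<Longrightarrow> conj G t y \<in> T" "\<And>t. t \<in> T \<Longrightarrow> conj G t (inv y) \<in> T"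
    and t: "t \<in> T"
  shows "conj G t (y [^] (l::int)) \<in> T"
proof (induction l rule: int_induct[where k = 0])
  case base
  then show ?case using t subgroup.mem_carrier[OF T] by simp
next
  case (step1 i)
  have "conj G t (y [^] (i + 1)) = conj G (conj G t (y [^] i)) y"
    using y t subgroup.mem_carrier[OF T] by (simp add: conj_conj int_pow_mult)
  then show ?case using step1 n by simp
next
  case (step2 i)
  have "conj G t (y [^] (i - 1)) = conj G (conj G t (y [^] i)) (inv y)"
    using y t subgroup.mem_carrier[OF T] by (simp add: conj_conj int_pow_diff)
  then show ?case using step2 n by simp
qed

text \<open>The set \<open>T<y>\<close> is closed under products because \<open>y^l1\<close> moves
  past \<open>t2\<close> at the cost of replacing \<open>t2\<close> by a conjugate, which stays in
  \<open>T\<close>.\<close>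

lemma generate_insert_normalizing:
  assumes T: "subgroup T G" and y: "y \<in> carrier G"
    and n: "\<And>t. t \<in> T \<Longrightarrow> conj G t y \<in> T" "\<And>t. t \<in> T \<Longrightarrow> conj G t (inv y) \<in> T"
    and g: "g \<in> generate G (insert y T)"
  shows "\<exists>t\<in>T. \<exists>l::int. g = t \<otimes> y [^] l"
  using g
proof (induction rule: generate.induct)
  case one
  then show ?case using subgroup.one_closed[OF T] by (intro bexI[of _ \<one>] exI[of _ 0]) auto
next
  case (incl h)
  show ?case
  proof (cases "h = y")
    case True
    then show ?thesis using y subgroup.one_closed[OF T] by (intro bexI[of _ \<one>] exI[of _ 1]) auto
  next
    case False
    then show ?thesis using incl subgroup.mem_carrier[OF T] by (intro bexI[of _ h] exI[of _ 0]) auto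
  qed
next
  case (inv h)
  show ?case
  proof (cases "h = y")
    case True
    then show ?thesis using y subgroup.one_closed[OF T] 
      by (intro bexI[of _ \<one>] exI[of _ "-1"]) (auto simp: int_pow_neg)
  next
    case False
    then show ?thesis using inv subgroup.mem_carrier[OF T] subgroup.m_inv_closed[OF T]
      by (intro bexI[of _ "inv h"] exI[of _ 0]) auto
  qed
next
  case (eng h1 h2)
  then obtain t1 t2 and l1 l2 :: int where
    *: "t1 \<in> T" "h1 = t1 \<otimes> y [^] l1" "t2 \<in> T" "h2 = t2 \<otimes> y [^] l2"
    by blast
  let ?t = "conj G t2 (y [^] (- l1))"
  have t: "?t \<in> T" using conj_subgroup_int_pow[OF T y n] * by blast
  note c = subgroup.mem_carrier[OF T]
  have "y [^] l1 \<otimes> t2 = ?t \<otimes> y [^] l1"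
    using mult_eq_mult_conj(2)[of t2 "y [^] l1"] y c[OF *(3)] by (simp add: int_pow_neg)
  then have "h1 \<otimes> h2 = (t1 \<otimes> ?t) \<otimes> y [^] (l1 + l2)"
    using mult_swap_middle[of t1 "y [^] l1" t2 ?t "y [^] l2"] c[OF *(1)] c[OF *(3)] c[OF t] y
    unfolding *(2,4) by (simp add: int_pow_mult)
  then show ?case using t * subgroup.m_closed[OF T] by blast
qed

lemma subgroup_commuting_pair:
  assumes "b \<in> carrier G" "c \<in> carrier G" "b \<otimes> c = c \<otimes> b"
  shows "subgroup {b [^] (i::int) \<otimes> c [^] (j::int) | i j. True} G" (is "subgroup ?T G")
proof (rule subgroupI)
  show "?T \<subseteq> carrier G" using assms by auto
  show "?T \<noteq> {}" by auto
next
  fix a assume "a \<in> ?T"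
  then obtain i j :: int where a: "a = b [^] i \<otimes> c [^] j" by blast
  have "inv a = b [^] (-i) \<otimes> c [^] (-j)"
    using assms comm_int_pow[OF assms, of "-i" "-j"] unfolding a
    by (simp add: inv_mult_group int_pow_neg)
  then show "inv a \<in> ?T" by blast
next
  fix a a' assume "a \<in> ?T" "a' \<in> ?T"
  then obtain i j i' j' :: int where a: "a = b [^] i \<otimes> c [^] j" "a' = b [^] i' \<otimes> c [^] j'" by blast
  have "c [^] j \<otimes> b [^] i' = b [^] i' \<otimes> c [^] j"
    using comm_int_pow[OF assms] by simp
  then have "a \<otimes> a' = b [^] (i + i') \<otimes> c [^] (j + j')"
    using mult_swap_middle[of "b [^] i" "c [^] j" "b [^] i'" "b [^] i'" "c [^] j'"] assms(1,2)
    unfolding a by (simp add: int_pow_mult)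
  then show "a \<otimes> a' \<in> ?T" by blast
qed

text \<open>The abelian subgroup \<open><b, c>\<close> is normalized by \<open>y\<close>, so
  \<open>generate_insert_normalizing\<close> applies to it. Here \<open>c\<close> is the commutator
  of \<open>b\<close> and \<open>y\<close>.\<close>

lemma generate_pair_normal_form:
  assumes carr: "b \<in> carrier G" "c \<in> carrier G" "y \<in> carrier G"
    and bc: "b \<otimes> c = c \<otimes> b" and conj_b: "conj G b y = b \<otimes> c"
    and cy: "conj G c y = c [^] (k::int)" "conj G c (inv y) = c [^] (k'::int)"
    and g: "g \<in> generate G {b, y}"
  shows "\<exists>(i::int) (j::int) (l::int). g = b [^] i \<otimes> c [^] j \<otimes> y [^] l"
proof -
  define T where "T = {b [^] (i::int) \<otimes> c [^] (j::int) | i j. True}"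
  have T: "subgroup T G"
    using subgroup_commuting_pair[OF carr(1,2) bc] by (simp add: T_def)
  have TI: "b [^] i \<otimes> c [^] j \<in> T" for i j :: int
    by (auto simp: T_def)
  have bT: "b \<in> T" using TI[of 1 0] carr by simp
  have cT: "c [^] i \<in> T" for i :: int using TI[of 0 i] carr by simp
  \<comment> \<open>Conjugating \<open>b^y = b c\<close> by \<open>inv y\<close> and solving for the
    image of \<open>b\<close> shows that this image again lies in \<open>T\<close>.\<close>
  have "b = conj G (b \<otimes> c) (inv y)" using conj_conj_inv(1)[of b y] carr by (simp add: conj_b)
  also have "\<dots> = conj G b (inv y) \<otimes> c [^] k'" using carr by (simp add: conj_mult cy)
  finally have conj_b': "conj G b (inv y) = b \<otimes> c [^] (- k')"
    using carr inv_solve_right[of "conj G b (inv y)" b "c [^] k'"] by (simp add: int_pow_neg)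
  have "conj G t u \<in> T" if t: "t \<in> T" and u: "u \<in> carrier G" "conj G b u \<in> T" "conj G c u \<in> T" for t u
  proof -
    obtain i j :: int where "t = b [^] i \<otimes> c [^] j" using t by (auto simp: T_def)
    then have "conj G t u = conj G b u [^] i \<otimes> conj G c u [^] j"
      using carr u(1) by (simp add: conj_mult conj_int_pow)
    also have "\<dots> \<in> T"
      by (intro subgroup.m_closed[OF T] subgroup_int_pow_closed[OF T] u)
    finally show ?thesis .
  qed
  moreover have "conj G b y \<in> T"
    using TI[of 1 1] carr unfolding conj_b by simp
  moreover have "conj G b (inv y) \<in> T"
    unfolding conj_b' by (intro subgroup.m_closed[OF T] bT cT)
  moreover have "conj G c y \<in> T" "conj G c (inv y) \<in> T"
    unfolding cy by (fact cT)+
  ultimately have n: "\<And>t. t \<in> T \<Longrightarrow> conj G t y \<in> T" "\<And>t. t \<in> T \<Longrightarrow> conj G t (inv y) \<in> T"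
    using carr by blast+
  have "{b, y} \<subseteq> insert y T" using bT by blast
  then have "g \<in> generate G (insert y T)"
    using g mono_generate[of "{b, y}" "insert y T"] by blast
  then have "\<exists>t\<in>T. \<exists>l::int. g = t \<otimes> y [^] l"
    using generate_insert_normalizing[OF T carr(3)] n by blast
  then show ?thesis
    unfolding T_def by blast
qed

end

section \<open>Elements of infinite order commuting with a non-abelian two-generator subgroup\<close>

context group
begin

section \<open>Divisibility in two-generator abelian groups\<close>

lemma ord_nonzero_if_int_pow_eq_one:
  assumes "x \<in> carrier G" "x [^] (n::int) = \<one>" "n \<noteq> 0"
  shows "ord x \<noteq> 0"
  using assms int_pow_eq_id[of x n] by auto

lemma comm_pair_mult:
  assumes "p \<in> carrier G" "q \<in> carrier G" "p \<otimes> q = q \<otimes> p"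
  shows "(p [^] (a::int) \<otimes> q [^] (b::int)) \<otimes> (p [^] (c::int) \<otimes> q [^] (d::int)) = p [^] (a + c) \<otimes> q [^] (b + d)"
  using mult_swap_middle[of "p [^] a" "q [^] b" "p [^] c" "p [^] c" "q [^] d"] comm_int_pow[OF assms] assms(1,2)
  by (simp add: int_pow_mult)

lemma comm_pair_int_pow:
  assumes "p \<in> carrier G" "q \<in> carrier G" "p \<otimes> q = q \<otimes> p"
  shows "(p [^] (a::int) \<otimes> q [^] (b::int)) [^] (n::int) = p [^] (a * n) \<otimes> q [^] (b * n)"
  using int_pow_mult_distrib[OF comm_int_pow[OF assms, of a b]] assms(1,2) by (simp add: int_pow_pow)

text \<open>The hypothesis makes \<open>w\<close> an \<open>i\<close>-th power in the abelian group
  \<open><p, q>\<close> for unboundedly large \<open>i\<close>. If \<open>p\<close> and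
  \<open>q\<close> are independent, \<open>i\<close> divides the fixed exponents of
  \<open>w\<close>, so \<open>w\<close> is trivial. Otherwise a fixed relation is compared with
  those that arise from large \<open>i\<close>.\<close>

lemma ord_nonzero_if_deeply_divisible:
  assumes carr: "p \<in> carrier G" "q \<in> carrier G" "w \<in> carrier G" and pq: "p \<otimes> q = q \<otimes> p"
    and div: "\<And>N::int. \<exists>i>N. \<exists>a b::int. w = p [^] (i * a) \<otimes> q [^] (i * b)"
  shows "ord w \<noteq> 0"
proof -
  note pow = comm_pair_int_pow[OF carr(1,2) pq]
  obtain a b :: int where w: "w = p [^] a \<otimes> q [^] b" using div by blast
  \<comment> \<open>Dividing the fixed expression of \<open>w\<close> by the one belonging to
    \<open>i\<close> yields a relation between \<open>p\<close> and \<open>q\<close>.\<close>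
  have rel: "\<exists>i>N. \<exists>a' b'. p [^] (a - i * a') \<otimes> q [^] (b - i * b') = \<one>" for N
  proof -
    obtain i a' b' where i: "i > N" "w = p [^] (i * a') \<otimes> q [^] (i * b')" using div by blast
    have "p [^] (a - i * a') \<otimes> q [^] (b - i * b')
        = w \<otimes> (p [^] (i * a') \<otimes> q [^] (i * b')) [^] (- 1 :: int)"
      unfolding pow w using comm_pair_mult[OF carr(1,2) pq] by simp
    also have "\<dots> = \<one>" unfolding i(2)[symmetric] using carr by (simp add: int_pow_neg)
    finally show ?thesis using i(1) by blast
  qed
  show ?thesis
  proof (cases "\<exists>(u::int) (v::int). (u, v) \<noteq> (0, 0) \<and> p [^] u \<otimes> q [^] v = \<one>")
    case False
    then have triv: "u = 0 \<and> v = 0" if "p [^] u \<otimes> q [^] v = \<one>" for u v :: int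
      using that by auto
    obtain i a' b' where i: "i > \<bar>a\<bar> + \<bar>b\<bar>" "p [^] (a - i * a') \<otimes> q [^] (b - i * b') = \<one>"
      using rel by blast
    then have "a = i * a'" "b = i * b'" using triv[OF i(2)] by linarith+
    then have "i dvd a" "i dvd b" by simp_all
    with i(1) have "a = 0" "b = 0"
      using dvd_imp_le_int[of a i] dvd_imp_le_int[of b i] by linarith+
    then show ?thesis using w carr by simp
  next
    case True
    then obtain u v :: int where uv: "u \<noteq> 0 \<or> v \<noteq> 0" "p [^] u \<otimes> q [^] v = \<one>" by auto
    obtain i a' b' where i: "i > \<bar>v * a - u * b\<bar>" "p [^] (a - i * a') \<otimes> q [^] (b - i * b') = \<one>"
      using rel by blast
    define u' v' where "u' = a - i * a'" and "v' = b - i * b'"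
    have uv': "p [^] u' \<otimes> q [^] v' = \<one>" using i by (simp add: u'_def v'_def)
    \<comment> \<open>The determinant of the relation vectors \<open>(u, v)\<close> and
      \<open>(u', v')\<close>. If it is nonzero, eliminating one generator at a time shows that its
      power kills both \<open>p\<close> and \<open>q\<close>, hence \<open>w\<close>.\<close>
    define \<Delta> where "\<Delta> = v * u' - u * v'"
    show ?thesis
    proof (cases "\<Delta> = 0")
      case False
      have "(p [^] u' \<otimes> q [^] v') [^] v \<otimes> (p [^] u \<otimes> q [^] v) [^] (- v') = \<one>"
        using uv(2) uv' by simp
      then have p: "p [^] \<Delta> = \<one>"
        unfolding pow comm_pair_mult[OF carr(1,2) pq] using carr by (simp add: \<Delta>_def algebra_simps)
      have "(p [^] u' \<otimes> q [^] v') [^] (- u) \<otimes> (p [^] u \<otimes> q [^] v) [^] u' = \<one>"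
        using uv(2) uv' by simp
      then have q: "q [^] \<Delta> = \<one>"
        unfolding pow comm_pair_mult[OF carr(1,2) pq] using carr by (simp add: \<Delta>_def algebra_simps)
      have "w [^] \<Delta> = (p [^] \<Delta>) [^] a \<otimes> (q [^] \<Delta>) [^] b"
        unfolding w pow using carr by (simp add: int_pow_pow mult.commute)
      then have "w [^] \<Delta> = \<one>" using p q by simp
      then show ?thesis using False ord_nonzero_if_int_pow_eq_one carr by blast
    next
      case True
      \<comment> \<open>For parallel relations \<open>i\<close> divides \<open>v a - u b\<close>. As
        \<open>i\<close> exceeds the absolute value of this number, it is 0, and \<open>w^u\<close>
        and \<open>w^v\<close> become powers of \<open>p^u q^v = \<one>\<close>.\<close>
      then have "v * a - u * b = i * (v * a' - u * b')"
        by (simp add: \<Delta>_def u'_def v'_def algebra_simps)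
      then have "i dvd v * a - u * b" by simp
      then have eq: "v * a = u * b"
        using i(1) dvd_imp_le_int[of "v * a - u * b" i] by auto
      have "w [^] u = (p [^] u \<otimes> q [^] v) [^] a"
        unfolding w pow using eq by (simp add: mult.commute)
      moreover have "w [^] v = (p [^] u \<otimes> q [^] v) [^] b"
        unfolding w pow using eq by (simp add: mult.commute)
      ultimately have "w [^] u = \<one>" "w [^] v = \<one>" using uv(2) by simp_all
      then show ?thesis using uv(1) ord_nonzero_if_int_pow_eq_one carr by blast
    qed
  qed
qed

section \<open>Case distinction on the commutator \<open>c\<close> of \<open>b\<close> and
  \<open>y\<close>\<close>

lemma comm_conj_trans:
  assumes "a \<in> carrier G" "x \<in> carrier G" "y \<in> carrier G" "a \<otimes> x = x \<otimes> a"
  shows "conj G a (x \<otimes> y) = conj G a y"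
  using assms conj_eq_self_iff[of a x] by (simp flip: conj_conj)

text \<open>The conjugates of \<open>b\<close> by the nonnegative powers of \<open>y\<close> all lie
  in the finite coset \<open>b<c>\<close>, so two of them coincide.\<close>

lemma pow_commutes_if_commutator_torsion:
  assumes carr: "b \<in> carrier G" "c \<in> carrier G" "y \<in> carrier G"
    and conj_b: "conj G b y = b \<otimes> c" and conj_c: "conj G c y = c [^] (k::int)" and c: "ord c \<noteq> 0"
  shows "\<exists>m>0. b \<otimes> y [^] (m::int) = y [^] m \<otimes> b"
proof -
  define f where "f l = conj G b (y [^] int l)" for l
  have "\<exists>j::int. f l = b \<otimes> c [^] j" for l
  proof (induction l)
    case 0
    then show ?case using carr by (auto simp: f_def intro!: exI[of _ 0])
  next
    case (Suc l)
    then obtain j :: int where j: "f l = b \<otimes> c [^] j" by blast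
    have "f (Suc l) = conj G (f l) y"
      using carr int_pow_mult[of y "int l" 1] by (simp add: f_def conj_conj add.commute)
    also have "\<dots> = b \<otimes> c [^] (1 + k * j)"
      using carr by (simp add: j conj_mult conj_b conj_int_pow conj_c int_pow_pow int_pow_mult m_assoc)
    finally show ?case by blast
  qed
  then have "range f \<subseteq> (\<lambda>g. b \<otimes> g) ` generate G {c}"
    using generate_pow[OF carr(2)] by blast
  moreover have "finite (generate G {c})"
    using c carr finite_cyclic_subgroup_order[of c] by (simp add: carrier_subgroup_generated)
  ultimately have "finite (range f)" using finite_subset by blast
  then have "\<not> inj f" using finite_imageD by blast
  then obtain l l' where ll: "l < l'" "f l = f l'"
    by (metis injI linorder_neqE_nat)
  have "b = conj G (f l') (inv (y [^] int l))"
    using carr ll(2) by (simp add: f_def [of l] flip: ll(2))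
  also have "\<dots> = conj G b (y [^] (int l' - int l))"
    using carr by (simp add: f_def conj_conj int_pow_diff)
  finally have "b \<otimes> y [^] (int l' - int l) = y [^] (int l' - int l) \<otimes> b"
    using conj_eq_self_iff carr by (metis int_pow_closed)
  then show ?thesis using ll(1) by (intro exI[of _ "int l' - int l"]) auto
qed


text \<open>For \<open>i\<close> congruent to 1 modulo a suitable \<open>e\<close>, the powers
  \<open>b^i\<close> and \<open>y^i\<close> still have commutator \<open>c\<close>, so
  \<open>w\<close> lies in \<open><b^i, y^i>\<close>. The \<open>e\<close>-th power of its normal
  form loses the factor from \<open><c>\<close>, so \<open>w^e\<close> is a product of
  \<open>i\<close>-th powers of \<open>b^e\<close> and \<open>y^e\<close> for unboundedly large
  \<open>i\<close>.\<close>

lemma ord_nonzero_commutator_torsion: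
  assumes carr: "b \<in> carrier G" "c \<in> carrier G" "y \<in> carrier G" "w \<in> carrier G"
    and bc: "b \<otimes> c = c \<otimes> b" and conj_b: "conj G b y = b \<otimes> c" and c1: "c \<noteq> \<one>"
    and conj_c: "conj G c y = c [^] (k::int)" "conj G c (inv y) = c [^] (k'::int)"
    and wy: "w \<otimes> y = y \<otimes> w"
    and w: "\<And>b' y'. \<lbrakk>b' \<in> generate G {b}; y' \<in> generate G {y}; b' \<otimes> y' \<noteq> y' \<otimes> b'\<rbrakk> \<Longrightarrow> w \<in> generate G {b', y'}"
    and c: "ord c \<noteq> 0"
  shows "ord w \<noteq> 0"
proof -
  obtain m :: int where m: "m > 0" "b \<otimes> y [^] m = y [^] m \<otimes> b"
    using pow_commutes_if_commutator_torsion[OF carr(1-3) conj_b conj_c(1) c] by blast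
  \<comment> \<open>This exponent kills \<open>c\<close> and makes \<open>y^e\<close> commute with
    \<open>b\<close>, and thereby with \<open>c\<close>.\<close>
  define e where "e = m * int (ord c)"
  have e: "e > 0" using m c by (simp add: e_def)
  have ce: "c [^] (e * j) = \<one>" for j
    using carr by (simp add: int_pow_eq_id e_def)
  have ey: "b \<otimes> y [^] (e * j) = y [^] (e * j) \<otimes> b" for j
    using comm_int_pow_left[OF _ carr(1) m(2)[symmetric], of "int (ord c) * j"] carr(3)
    by (simp add: int_pow_pow e_def mult.assoc)
  have cey: "c \<otimes> y [^] (e * j) = y [^] (e * j) \<otimes> c" for j
  proof -
    have "c = inv b \<otimes> conj G b y" using carr by (simp add: conj_b m_assoc [symmetric])
    moreover have "(inv b \<otimes> conj G b y) \<otimes> y [^] (e * j) = y [^] (e * j) \<otimes> (inv b \<otimes> conj G b y)"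
      unfolding conj_def using carr ey comm_int_pow_left[OF carr(3,3)]
      by (intro comm_mult_left comm_inv_left) (auto simp flip: int_pow_neg)
    ultimately show ?thesis by simp
  qed
  have "\<exists>i>N. \<exists>\<alpha> \<gamma>::int. w [^] e = (b [^] e) [^] (i * \<alpha>) \<otimes> (y [^] e) [^] (i * \<gamma>)" for N :: int
  proof -
    \<comment> \<open>Larger than \<open>N\<close> and congruent to 1 modulo \<open>e\<close>, so
      that \<open>y^i\<close> acts as \<open>y\<close> does and \<open>c^i = c\<close>.\<close>
    define i where "i = e * \<bar>N\<bar> + 1"
    have "\<bar>N\<bar> \<le> e * \<bar>N\<bar>" using e by (simp add: mult_le_cancel_right1)
    then have iN: "i > N" by (simp add: i_def)
    have yi: "y [^] i = y [^] (e * \<bar>N\<bar>) \<otimes> y" using carr by (simp add: i_def int_pow_mult)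
    have yi': "inv (y [^] i) = y [^] (e * - \<bar>N\<bar>) \<otimes> inv y"
      using carr int_pow_diff[of y "- (e * \<bar>N\<bar>)" 1] by (simp add: i_def int_pow_neg [symmetric])
    have ci: "c [^] i = c" using carr ce by (simp add: i_def int_pow_mult)
    have 1: "conj G b (y [^] i) = b \<otimes> c" using carr ey comm_conj_trans by (simp add: yi conj_b)
    have 2: "conj G (b [^] i) (y [^] i) = b [^] i \<otimes> c"
      using carr by (simp add: conj_int_pow 1 int_pow_mult_distrib[OF bc] ci)
    have 3: "conj G c (y [^] i) = c [^] k" using carr cey comm_conj_trans by (simp add: yi conj_c)
    have 4: "conj G c (inv (y [^] i)) = c [^] k'"
      unfolding yi' using carr cey[of "- \<bar>N\<bar>"] comm_conj_trans by (simp add: conj_c)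
    have "b [^] i \<otimes> y [^] i \<noteq> y [^] i \<otimes> b [^] i"
      using conj_eq_self_iff[of "b [^] i" "y [^] i"] 2 carr c1 by simp
    then have "w \<in> generate G {b [^] i, y [^] i}" using w carr by (auto simp: generate_pow)
    then obtain \<alpha> \<beta> \<gamma> :: int where
      "w = (b [^] i) [^] \<alpha> \<otimes> c [^] \<beta> \<otimes> (y [^] i) [^] \<gamma>"
      using generate_pair_normal_form[OF _ carr(2) _ comm_int_pow_left[OF carr(1,2) bc] 2 3 4] carr by blast
    then have weq: "w = (b [^] (i * \<alpha>) \<otimes> c [^] \<beta>) \<otimes> y [^] (i * \<gamma>)"
      using carr by (simp add: int_pow_pow)
    define t where "t = b [^] (i * \<alpha>) \<otimes> c [^] \<beta>"
    have t: "t \<in> carrier G" using carr by (simp add: t_def)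
    have "t = w \<otimes> inv (y [^] (i * \<gamma>))" using weq carr t by (simp add: t_def [symmetric] m_assoc)
    \<comment> \<open>As \<open>w\<close> and the powers of \<open>y\<close> commute with
      \<open>y\<close>, so does \<open>t\<close>; hence the \<open>e\<close>-th power of
      \<open>w\<close> can be taken factor by factor.\<close>
    then have "t \<otimes> y = y \<otimes> t"
      using carr wy comm_int_pow_left[OF carr(3,3)] by (auto intro!: comm_mult_left comm_inv_left)
    then have comm: "t \<otimes> y [^] (i * \<gamma>) = y [^] (i * \<gamma>) \<otimes> t"
      using comm_int_pow_left[OF carr(3) t] by simp
    have "w [^] e = t [^] e \<otimes> y [^] (i * \<gamma> * e)"
      unfolding weq t_def [symmetric] using t carr by (simp add: int_pow_mult_distrib[OF comm] int_pow_pow)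
    also have "t [^] e = b [^] (i * \<alpha> * e)"
      unfolding t_def comm_pair_int_pow[OF carr(1,2) bc] using ce[of \<beta>] carr by (simp add: mult.commute)
    finally have "w [^] e = (b [^] e) [^] (i * \<alpha>) \<otimes> (y [^] e) [^] (i * \<gamma>)"
      using carr by (simp add: int_pow_pow mult_ac)
    then show ?thesis using iN by blast
  qed
  moreover have "b [^] e \<otimes> y [^] e = y [^] e \<otimes> b [^] e"
    using comm_int_pow_left[OF carr(1), of "y [^] e" e] ey[of 1] carr by simp
  ultimately have "ord (w [^] e) \<noteq> 0"
    using ord_nonzero_if_deeply_divisible[of "b [^] e" "y [^] e" "w [^] e"] carr by blast
  then have "(w [^] e) [^] int (ord (w [^] e)) = \<one>" using carr by (simp add: int_pow_int)
  then have "w [^] (e * int (ord (w [^] e))) = \<one>" using carr by (simp add: int_pow_pow)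
  then show ?thesis using ord_nonzero_if_int_pow_eq_one carr e \<open>ord (w [^] e) \<noteq> 0\<close> by auto
qed

text \<open>Here \<open>y^2\<close> centralizes \<open>b\<close> and \<open>c\<close>. For odd
  \<open>i\<close> the group \<open><b^i, y^i>\<close> has the nontrivial commutator
  \<open>c^i\<close>, so it contains \<open>w\<close>. Since \<open>w\<close> commutes with
  \<open>y\<close>, the part of its normal form in \<open><b, c>\<close> is fixed by
  \<open>y\<close>, which forces it to be an \<open>i\<close>-th power in \<open><p>\<close> with
  \<open>p = b^2 c\<close>.\<close>

lemma ord_nonzero_commutator_inverted:
  assumes carr: "b \<in> carrier G" "c \<in> carrier G" "y \<in> carrier G" "w \<in> carrier G"
    and bc: "b \<otimes> c = c \<otimes> b" and conj_b: "conj G b y = b \<otimes> c"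
    and conj_c: "conj G c y = inv c"
    and wy: "w \<otimes> y = y \<otimes> w"
    and w: "\<And>b' y'. \<lbrakk>b' \<in> generate G {b}; y' \<in> generate G {y}; b' \<otimes> y' \<noteq> y' \<otimes> b'\<rbrakk> \<Longrightarrow> w \<in> generate G {b', y'}"
    and c: "ord c = 0"
  shows "ord w \<noteq> 0"
proof -
  have c0: "c [^] n = \<one> \<longleftrightarrow> n = 0" for n :: int using carr c by (simp add: int_pow_eq_id)
  have conj_c': "conj G c (inv y) = inv c"
    using conj_conj_inv(1)[of "inv c" y] carr conj_c by (simp add: conj_inv)
  have "conj G b (y \<otimes> y) = b" using carr by (simp add: conj_mult conj_b conj_c m_assoc flip: conj_conj)
  moreover have "conj G c (y \<otimes> y) = c" using carr by (simp add: conj_inv conj_c flip: conj_conj)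
  ultimately have "b \<otimes> (y \<otimes> y) = (y \<otimes> y) \<otimes> b" "c \<otimes> (y \<otimes> y) = (y \<otimes> y) \<otimes> c"
    using conj_eq_self_iff[of _ "y \<otimes> y"] carr by blast+
  moreover have "(y \<otimes> y) [^] j = y [^] (2 * j)" for j :: int
  proof -
    have "y \<otimes> y = y [^] (2::int)" using carr int_pow_mult[of y 1 1] by simp
    then show ?thesis using carr by (simp add: int_pow_pow)
  qed
  ultimately have y2: "b \<otimes> y [^] (2 * j) = y [^] (2 * j) \<otimes> b" "c \<otimes> y [^] (2 * j) = y [^] (2 * j) \<otimes> c" for j :: int
    using comm_int_pow_left[of "y \<otimes> y" b j] comm_int_pow_left[of "y \<otimes> y" c j] carr by simp_all
  \<comment> \<open>Fixed by \<open>y\<close>: conjugation turns \<open>b^2\<close> into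
    \<open>b^2 c^2\<close> and \<open>c\<close> into \<open>inv c\<close>.\<close>
  define p where "p = b \<otimes> b \<otimes> c"
  have p: "p \<in> carrier G" using carr by (simp add: p_def)
  have "conj G p y = b \<otimes> (c \<otimes> b) \<otimes> (c \<otimes> inv c)"
    using carr by (simp add: p_def conj_mult conj_b conj_c m_assoc)
  also have "\<dots> = p" using carr by (simp add: bc [symmetric] p_def m_assoc)
  finally have py: "p \<otimes> y = y \<otimes> p" using conj_eq_self_iff[of p y] p carr by simp
  have ppow: "p [^] j = b [^] (2 * j) \<otimes> c [^] j" for j :: int
  proof -
    have "p = b [^] (2::int) \<otimes> c [^] (1::int)" using carr int_pow_mult[of b 1 1] by (simp add: p_def)
    then show ?thesis by (simp only: comm_pair_int_pow[OF carr(1,2) bc] mult_1)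
  qed
  have "\<exists>i>N. \<exists>\<beta> \<gamma>::int. w = p [^] (i * \<beta>) \<otimes> y [^] (i * \<gamma>)" for N :: int
  proof -
    define i where "i = 2 * \<bar>N\<bar> + 1"
    have iN: "i > N" "i \<noteq> 0" by (simp_all add: i_def)
    have yi: "y [^] i = y [^] (2 * \<bar>N\<bar>) \<otimes> y" using carr by (simp add: i_def int_pow_mult)
    have yi': "inv (y [^] i) = y [^] (2 * - \<bar>N\<bar>) \<otimes> inv y"
      using carr int_pow_diff[of y "- (2 * \<bar>N\<bar>)" 1] by (simp add: i_def int_pow_neg [symmetric])
    have 1: "conj G b (y [^] i) = b \<otimes> c" using carr y2 comm_conj_trans by (simp add: yi conj_b)
    have 2: "conj G (b [^] i) (y [^] i) = b [^] i \<otimes> c [^] i"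
      using carr by (simp add: conj_int_pow 1 int_pow_mult_distrib[OF bc])
    have 3: "conj G (c [^] i) (y [^] i) = (c [^] i) [^] (- 1::int)"
      using carr y2 comm_conj_trans by (simp add: conj_int_pow yi conj_c int_pow_inv int_pow_neg)
    have 4: "conj G (c [^] i) (inv (y [^] i)) = (c [^] i) [^] (- 1::int)"
      unfolding yi' using carr y2(2)[of "- \<bar>N\<bar>"] comm_conj_trans
      by (simp add: conj_int_pow conj_c' int_pow_inv int_pow_neg)
    have "b [^] i \<otimes> y [^] i \<noteq> y [^] i \<otimes> b [^] i"
      using conj_eq_self_iff[of "b [^] i" "y [^] i"] 2 carr c0 iN by simp
    then have "w \<in> generate G {b [^] i, y [^] i}" using w carr by (auto simp: generate_pow)
    then obtain \<alpha> \<beta> \<gamma> :: int where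
      "w = (b [^] i) [^] \<alpha> \<otimes> (c [^] i) [^] \<beta> \<otimes> (y [^] i) [^] \<gamma>"
      using generate_pair_normal_form[OF _ _ _ comm_int_pow[OF carr(1,2) bc] 2 3 4] carr by blast
    then have weq: "w = (b [^] (i * \<alpha>) \<otimes> c [^] (i * \<beta>)) \<otimes> y [^] (i * \<gamma>)"
      using carr by (simp add: int_pow_pow)
    define t where "t = b [^] (i * \<alpha>) \<otimes> c [^] (i * \<beta>)"
    have t: "t \<in> carrier G" using carr by (simp add: t_def)
    have "t = w \<otimes> inv (y [^] (i * \<gamma>))" using weq carr t by (simp add: t_def [symmetric] m_assoc)
    then have "t \<otimes> y = y \<otimes> t"
      using carr wy comm_int_pow_left[OF carr(3,3)] by (auto intro!: comm_mult_left comm_inv_left)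
    \<comment> \<open>The powers of \<open>b\<close> agree on both sides; comparing those of
      \<open>c\<close>, which has infinite order, gives \<open>\<alpha> = 2 * \<beta>\<close>, so
      \<open>t\<close> is a power of \<open>p\<close>.\<close>
    then have "t = conj G t y" using conj_eq_self_iff[of t y] t carr by simp
    also have "\<dots> = (b \<otimes> c) [^] (i * \<alpha>) \<otimes> inv c [^] (i * \<beta>)"
      using carr by (simp add: t_def conj_mult conj_int_pow conj_b conj_c)
    also have "\<dots> = b [^] (i * \<alpha>) \<otimes> c [^] (i * \<alpha> - i * \<beta>)"
      using carr by (simp add: int_pow_mult_distrib[OF bc] int_pow_diff int_pow_inv m_assoc)
    finally have "c [^] (i * \<beta>) = c [^] (i * \<alpha> - i * \<beta>)" using carr by (simp add: t_def)
    then have "c [^] (i * \<beta> - (i * \<alpha> - i * \<beta>)) = \<one>" using carr by (simp only: int_pow_diff) simp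
    then have "i * (2 * \<beta> - \<alpha>) = 0" unfolding c0 by (simp add: algebra_simps)
    then have "\<alpha> = 2 * \<beta>" using iN by simp
    then have "w = p [^] (i * \<beta>) \<otimes> y [^] (i * \<gamma>)" using weq by (simp add: ppow mult_ac)
    then show ?thesis using iN by blast
  qed
  then show ?thesis using ord_nonzero_if_deeply_divisible[OF p carr(3,4) py] by blast
qed

text \<open>Here \<open><b, y>\<close> has class 2, and \<open>b^i\<close> and \<open>y\<close> have
  commutator \<open>c^i\<close>. Commuting with \<open>b\<close> removes the power of
  \<open>y\<close> from the normal form of \<open>w\<close>, and commuting with \<open>y\<close>
  then removes the power of \<open>b\<close>. So \<open>w\<close> lies in \<open><c^i>\<close> for
  unboundedly large \<open>i\<close>.\<close>

lemma ord_nonzero_commutator_central: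
  assumes carr: "b \<in> carrier G" "c \<in> carrier G" "y \<in> carrier G" "w \<in> carrier G"
    and bc: "b \<otimes> c = c \<otimes> b" and conj_b: "conj G b y = b \<otimes> c"
    and cy: "c \<otimes> y = y \<otimes> c"
    and wb: "w \<otimes> b = b \<otimes> w" and wy: "w \<otimes> y = y \<otimes> w"
    and w: "\<And>b' y'. \<lbrakk>b' \<in> generate G {b}; y' \<in> generate G {y}; b' \<otimes> y' \<noteq> y' \<otimes> b'\<rbrakk> \<Longrightarrow> w \<in> generate G {b', y'}"
    and c: "ord c = 0"
  shows "ord w \<noteq> 0"
proof -
  have c0: "c [^] n = \<one> \<longleftrightarrow> n = 0" for n :: int using carr c by (simp add: int_pow_eq_id)
  \<comment> \<open>The commutator read from the other side; it tells when a power of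
    \<open>y\<close> commutes with \<open>b\<close>.\<close>
  have "y \<otimes> inv c = conj G y b"
  proof -
    have "conj G y b = inv b \<otimes> (y \<otimes> b)" using carr by (simp add: conj_def m_assoc)
    also have "y \<otimes> b = b \<otimes> (y \<otimes> inv c)"
    proof -
      have "b \<otimes> y = y \<otimes> (b \<otimes> c)" using mult_eq_mult_conj(1)[of b y] carr conj_b by simp
      then have "b \<otimes> y \<otimes> inv c = y \<otimes> b" using carr by (simp add: m_assoc)
      then show ?thesis using carr by (simp add: m_assoc)
    qed
    finally show ?thesis using carr by (simp add: m_assoc [symmetric])
  qed
  then have ypow: "conj G (y [^] l) b = y [^] l \<otimes> c [^] (- l)" for l :: int
    using carr comm_inv_left[OF carr(2,3) cy]
    by (simp add: conj_int_pow int_pow_mult_distrib int_pow_inv int_pow_neg flip: \<open>y \<otimes> inv c = conj G y b\<close>)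
  have "\<exists>i>N. \<exists>\<beta> \<gamma>::int. w = c [^] (i * \<beta>) \<otimes> \<one> [^] (i * \<gamma>)" for N :: int
  proof -
    define i where "i = \<bar>N\<bar> + 1"
    have iN: "i > N" "i \<noteq> 0" by (simp_all add: i_def)
    have 2: "conj G (b [^] i) y = b [^] i \<otimes> c [^] i"
      using carr by (simp add: conj_int_pow conj_b int_pow_mult_distrib[OF bc])
    have 3: "conj G (c [^] i) y = (c [^] i) [^] (1::int)"
      using carr cy conj_eq_self_iff[of c y] by (simp add: conj_int_pow)
    have 4: "conj G (c [^] i) (inv y) = (c [^] i) [^] (1::int)"
      using carr comm_inv_left[of y c] cy conj_eq_self_iff[of c "inv y"] by (simp add: conj_int_pow)
    have "b [^] i \<otimes> y \<noteq> y \<otimes> b [^] i"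
      using conj_eq_self_iff[of "b [^] i" y] 2 carr c0 iN by simp
    moreover have "y \<in> generate G {y}" by (simp add: generate.incl)
    ultimately have "w \<in> generate G {b [^] i, y}" using w carr by (auto simp: generate_pow)
    then obtain \<alpha> \<beta> \<gamma> :: int where
      "w = (b [^] i) [^] \<alpha> \<otimes> (c [^] i) [^] \<beta> \<otimes> y [^] \<gamma>"
      using generate_pair_normal_form[OF _ _ _ comm_int_pow[OF carr(1,2) bc] 2 3 4] carr by blast
    then have weq: "w = (b [^] (i * \<alpha>) \<otimes> c [^] (i * \<beta>)) \<otimes> y [^] \<gamma>"
      using carr by (simp add: int_pow_pow)
    define t where "t = b [^] (i * \<alpha>) \<otimes> c [^] (i * \<beta>)"
    have t: "t \<in> carrier G" "t \<otimes> b = b \<otimes> t"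
      using carr bc comm_int_pow_left[OF carr(1,1)] comm_int_pow_left[OF carr(2,1)]
      by (auto simp: t_def intro!: comm_mult_left)
    have "y [^] \<gamma> = inv t \<otimes> w" using weq carr t by (simp add: t_def [symmetric] m_assoc [symmetric])
    then have "y [^] \<gamma> \<otimes> b = b \<otimes> y [^] \<gamma>"
      using carr wb t by (auto intro!: comm_mult_left comm_inv_left)
    then have "c [^] (- \<gamma>) = \<one>" using ypow[of \<gamma>] conj_eq_self_iff[of "y [^] \<gamma>" b] carr by simp
    then have "\<gamma> = 0" by (simp add: c0)
    then have weq: "w = b [^] (i * \<alpha>) \<otimes> c [^] (i * \<beta>)" using weq carr by simp
    then have "b [^] (i * \<alpha>) = w \<otimes> inv (c [^] (i * \<beta>))" using carr by (simp add: m_assoc)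
    then have "b [^] (i * \<alpha>) \<otimes> y = y \<otimes> b [^] (i * \<alpha>)"
      using carr wy comm_int_pow_left[OF carr(2,3) cy] by (auto intro!: comm_mult_left comm_inv_left)
    then have "b [^] (i * \<alpha>) = (b \<otimes> c) [^] (i * \<alpha>)"
      using conj_eq_self_iff[of "b [^] (i * \<alpha>)" y] carr by (simp add: conj_int_pow conj_b)
    then have "c [^] (i * \<alpha>) = \<one>" using carr by (simp add: int_pow_mult_distrib[OF bc])
    then have "\<alpha> = 0" using iN by (simp add: c0)
    then have "w = c [^] (i * \<beta>) \<otimes> \<one> [^] (i * 0)" using weq carr by simp
    then show ?thesis using iN by blast
  qed
  \<comment> \<open>Only \<open>c\<close> is left, so the second generator is taken to be
    trivial.\<close>
  then show ?thesis using ord_nonzero_if_deeply_divisible[of c \<one> w] carr by simp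
qed

text \<open>If \<open>c\<close> has infinite order, conjugating it by \<open>y\<close> and back
  gives \<open>k' k = 1\<close>, so \<open>y\<close> centralizes or inverts \<open>c\<close>. The
  hypothesis on \<open>b'\<close> and \<open>y'\<close> is what self-centralizing non-abelian
  subgroups provide for a \<open>w\<close> commuting with \<open>b\<close> and
  \<open>y\<close>.\<close>

lemma ord_nonzero_central_in_nonabelian:
  assumes carr: "b \<in> carrier G" "c \<in> carrier G" "y \<in> carrier G" "w \<in> carrier G"
    and bc: "b \<otimes> c = c \<otimes> b" and conj_b: "conj G b y = b \<otimes> c" and c1: "c \<noteq> \<one>"
    and conj_c: "conj G c y = c [^] (k::int)" "conj G c (inv y) = c [^] (k'::int)"
    and wb: "w \<otimes> b = b \<otimes> w" and wy: "w \<otimes> y = y \<otimes> w"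
    and w: "\<And>b' y'. \<lbrakk>b' \<in> generate G {b}; y' \<in> generate G {y}; b' \<otimes> y' \<noteq> y' \<otimes> b'\<rbrakk> \<Longrightarrow> w \<in> generate G {b', y'}"
  shows "ord w \<noteq> 0"
proof (cases "ord c = 0")
  case False
  then show ?thesis using ord_nonzero_commutator_torsion[OF carr bc conj_b c1 conj_c wy w] by blast
next
  case True
  have "c = conj G (conj G c y) (inv y)" using carr by simp
  also have "\<dots> = c [^] (k' * k)" using carr by (simp add: conj_c conj_int_pow int_pow_pow)
  finally have "c [^] (1::int) = c [^] (k' * k)" using carr by simp
  then have "k' * k = 1" using int_pow_eq[OF carr(2)] True by simp
  then consider "k = 1" | "k = - 1" by (metis zmult_eq_1_iff)
  then show ?thesis
  proof cases
    case 1
    then have "c \<otimes> y = y \<otimes> c" using conj_c conj_eq_self_iff[of c y] carr by simp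
    then show ?thesis using ord_nonzero_commutator_central[OF carr bc conj_b _ wb wy w True] by blast
  next
    case 2
    then have "conj G c y = inv c" using conj_c carr by (simp add: int_pow_neg)
    then show ?thesis using ord_nonzero_commutator_inverted[OF carr bc conj_b _ wy w True] by blast
  qed
qed

end

section \<open>Supersoluble series\<close>

text \<open>For \<open>M\<close> normal and contained in \<open>N\<close>, the coset of
  \<open>t\<close> generates \<open>N/M\<close>. The elementwise form needs no quotient group and is
  convenient for intersecting with subgroups.\<close>

definition cyclic_modulo :: "('a, 'b) monoid_scheme \<Rightarrow> 'a set \<Rightarrow> 'a set \<Rightarrow> 'a \<Rightarrow> bool" where
  "cyclic_modulo G M N t \<longleftrightarrow> t \<in> N \<and> (\<forall>g\<in>N. \<exists>m\<in>M. \<exists>k::int. g = m \<otimes>\<^bsub>G\<^esub> t [^]\<^bsub>G\<^esub> k)"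

context group
begin

lemma cyclic_modulo_if_cyclic_factor:
  assumes N: "subgroup N G" and M: "M \<lhd> G" "M \<subseteq> N"
    and cyc: "cyclic_group ((G\<lparr>carrier := N\<rparr>) Mod M)"
  shows "\<exists>t. cyclic_modulo G M N t"
proof -
  interpret MN: normal M "G\<lparr>carrier := N\<rparr>"
    using normal_restrict_supergroup[OF N M] .
  interpret F: group "(G\<lparr>carrier := N\<rparr>) Mod M" by (rule MN.factorgroup_is_group)
  obtain U where U: "U \<in> carrier ((G\<lparr>carrier := N\<rparr>) Mod M)"
      "carrier ((G\<lparr>carrier := N\<rparr>) Mod M) = range (\<lambda>n::int. U [^]\<^bsub>(G\<lparr>carrier := N\<rparr>) Mod M\<^esub> n)"
    using cyc F.cyclic_group by blast
  obtain t where t: "t \<in> N" "U = M #>\<^bsub>G\<lparr>carrier := N\<rparr>\<^esub> t"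
    using U(1) unfolding carrier_FactGroup by auto
  have "\<exists>m\<in>M. \<exists>k::int. g = m \<otimes> t [^] k" if g: "g \<in> N" for g
  proof -
    have "M #>\<^bsub>G\<lparr>carrier := N\<rparr>\<^esub> g \<in> carrier ((G\<lparr>carrier := N\<rparr>) Mod M)"
      using g by (auto simp: carrier_FactGroup)
    then obtain k :: int where "M #>\<^bsub>G\<lparr>carrier := N\<rparr>\<^esub> g = U [^]\<^bsub>(G\<lparr>carrier := N\<rparr>) Mod M\<^esub> k"
      using U(2) by blast
    also have "\<dots> = M #>\<^bsub>G\<lparr>carrier := N\<rparr>\<^esub> (t [^]\<^bsub>G\<lparr>carrier := N\<rparr>\<^esub> k)"
      using MN.FactGroup_int_pow t by simp
    also have "\<dots> = M #> t [^] k"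
      using int_pow_consistent[OF N t(1)] by simp
    finally have "M #> g = M #> t [^] k" by simp
    then have "g \<in> M #> t [^] k"
      using rcos_self[of g M] g subgroup.mem_carrier[OF N] normal_imp_subgroup[OF M(1)] by blast
    then show ?thesis by (auto simp: r_coset_def)
  qed
  then show ?thesis using t(1) by (auto simp: cyclic_modulo_def)
qed

lemma normal_conj_closed:
  assumes "M \<lhd> G" "m \<in> M" "x \<in> carrier G" shows "conj G m x \<in> M"
  using normal.inv_op_closed1[OF assms(1,3,2)] by (simp add: conj_def)

text \<open>The elements \<open>m t\<close> and \<open>t\<close> have the same coset modulo
  \<open>M\<close>, hence so do their powers.\<close>

lemma normal_mult_int_pow:
  assumes M: "M \<lhd> G" and m: "m \<in> M" and t: "t \<in> carrier G"
  shows "\<exists>m'\<in>M. (m \<otimes> t) [^] (k::int) = m' \<otimes> t [^] k"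
proof -
  note sub = normal_imp_subgroup[OF M]
  have mG: "m \<in> carrier G" using subgroup.mem_carrier[OF sub m] .
  have "m \<otimes> t \<in> M #> t" using m by (auto simp: r_coset_def)
  then have "M #> (m \<otimes> t) = M #> t" using repr_independence[OF _ t sub] by simp
  then have "M #> ((m \<otimes> t) [^] k) = M #> t [^] k"
    using normal.FactGroup_int_pow[OF M, of "m \<otimes> t" k] normal.FactGroup_int_pow[OF M, of t k] t mG by simp
  then have "(m \<otimes> t) [^] k \<in> M #> t [^] k"
    using rcos_self[OF _ sub, of "(m \<otimes> t) [^] k"] t mG by simp
  then show ?thesis by (auto simp: r_coset_def)
qed

text \<open>The factor of \<open>N \<inter> K\<close> by \<open>M \<inter> K\<close> embeds in the
  cyclic \<open>N/M\<close>. Concretely, the exponents \<open>k\<close> for which the coset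
  \<open>M t^k\<close> meets \<open>K\<close> form a subgroup of the integers, and its least
  positive member yields the new generator.\<close>

lemma cyclic_modulo_Int:
  assumes M: "M \<lhd> G" and MN: "M \<subseteq> N" and N: "subgroup N G" and K: "subgroup K G"
    and t: "cyclic_modulo G M N t"
  shows "\<exists>t'. cyclic_modulo G (M \<inter> K) (N \<inter> K) t'"
proof -
  note Msub = normal_imp_subgroup[OF M]
  note MG = subgroup.mem_carrier[OF Msub]
  have tN: "t \<in> N" and rep: "\<And>g. g \<in> N \<Longrightarrow> \<exists>m\<in>M. \<exists>k::int. g = m \<otimes> t [^] k"
    using t by (auto simp: cyclic_modulo_def)
  have tG: "t \<in> carrier G" using tN subgroup.mem_carrier[OF N] by blast
  define E where "E = {k::int. \<exists>m\<in>M. m \<otimes> t [^] k \<in> K}"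
  \<comment> \<open>Division with remainder on exponents: up to a factor from \<open>M\<close>, the
    product \<open>u v^(-q)\<close> has exponent \<open>k - q e\<close>.\<close>
  have red: "\<exists>m\<in>M. u \<otimes> v [^] (- q) = m \<otimes> t [^] (k - q * e)"
    if u: "m1 \<in> M" "u = m1 \<otimes> t [^] k" and v: "m2 \<in> M" "v = m2 \<otimes> t [^] e" for u v m1 m2 and k e q :: int
  proof -
    obtain m' where m': "m' \<in> M" "v [^] (- q) = m' \<otimes> (t [^] e) [^] (- q)"
      using normal_mult_int_pow[OF M v(1), of "t [^] e" "- q"] tG v(2) by auto
    let ?c = "conj G m' (inv (t [^] k))"
    have c: "?c \<in> M" using normal_conj_closed[OF M m'(1)] tG by simp
    have "u \<otimes> v [^] (- q) = (m1 \<otimes> ?c) \<otimes> (t [^] k \<otimes> (t [^] e) [^] (- q))"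
      unfolding u(2) m'(2) using u(1) c m'(1) tG MG
      by (intro mult_swap_middle mult_eq_mult_conj(2)) auto
    also have "t [^] k \<otimes> (t [^] e) [^] (- q) = t [^] (k - q * e)"
      using tG by (simp add: int_pow_pow int_pow_mult [symmetric] mult.commute)
    finally show ?thesis using subgroup.m_closed[OF Msub u(1) c] by blast
  qed
  have E_diff: "k - q * e \<in> E" if "k \<in> E" "e \<in> E" for k e q :: int
  proof -
    obtain m1 m2 where m: "m1 \<in> M" "m1 \<otimes> t [^] k \<in> K" "m2 \<in> M" "m2 \<otimes> t [^] e \<in> K"
      using \<open>k \<in> E\<close> \<open>e \<in> E\<close> by (auto simp: E_def)
    have "(m1 \<otimes> t [^] k) \<otimes> (m2 \<otimes> t [^] e) [^] (- q) \<in> K"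
      using subgroup.m_closed[OF K m(2) subgroup_int_pow_closed[OF K m(4)]] .
    then show ?thesis using red[OF m(1) refl m(3) refl, of k e q] unfolding E_def by auto
  qed
  show ?thesis
  proof (cases "E \<subseteq> {0}")
    case True
    \<comment> \<open>If only the exponent 0 occurs, every element of \<open>N \<inter> K\<close> is
      already in \<open>M\<close>.\<close>
    have "cyclic_modulo G (M \<inter> K) (N \<inter> K) \<one>"
      unfolding cyclic_modulo_def
    proof (intro conjI ballI)
      show "\<one> \<in> N \<inter> K" using subgroup.one_closed N K by blast
    next
      fix g assume g: "g \<in> N \<inter> K"
      then obtain m k where m: "m \<in> M" "g = m \<otimes> t [^] (k::int)" using rep by blast
      then have "k \<in> E" using g by (auto simp: E_def)
      then have "k = 0" using True by auto
      then have "g = m" using m tG MG by simp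
      then show "\<exists>m\<in>M \<inter> K. \<exists>k::int. g = m \<otimes> \<one> [^] k"
        using m g MG by (intro bexI[of _ m]) auto
    qed
    then show ?thesis by blast
  next
    case False
    then obtain e0 where e0: "e0 \<in> E" "e0 \<noteq> 0" by auto
    have "0 \<in> E" using E_diff[OF e0(1) e0(1), of 1] by simp
    then have "\<bar>e0\<bar> \<in> E" using E_diff[of 0 e0 1] e0 by (auto simp: abs_if)
    then have ex: "\<exists>n::nat. 0 < n \<and> int n \<in> E" using e0(2) by (intro exI[of _ "nat \<bar>e0\<bar>"]) auto
    define n where "n = (LEAST n::nat. 0 < n \<and> int n \<in> E)"
    have n: "0 < n" "int n \<in> E" using LeastI_ex[OF ex] by (auto simp: n_def)
    have n_least: "\<not> int j \<in> E" if "0 < j" "j < n" for j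
      using not_less_Least[of j "\<lambda>n. 0 < n \<and> int n \<in> E"] that by (auto simp: n_def)
    obtain m0 where m0: "m0 \<in> M" "m0 \<otimes> t [^] int n \<in> K" using n(2) by (auto simp: E_def)
    define t' where "t' = m0 \<otimes> t [^] int n"
    have t'N: "t' \<in> N"
      using subgroup.m_closed[OF N] m0 MN subgroup_int_pow_closed[OF N tN] by (auto simp: t'_def)
    have t'K: "t' \<in> K" using m0 by (simp add: t'_def)
    have t'G: "t' \<in> carrier G" using t'N subgroup.mem_carrier[OF N] by blast
    have "cyclic_modulo G (M \<inter> K) (N \<inter> K) t'"
      unfolding cyclic_modulo_def
    proof (intro conjI ballI)
      show "t' \<in> N \<inter> K" using t'N t'K by blast
    next
      fix g assume g: "g \<in> N \<inter> K"
      then have gG: "g \<in> carrier G" using subgroup.mem_carrier[OF N] by blast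
      obtain m k where m: "m \<in> M" "g = m \<otimes> t [^] (k::int)" using rep g by blast
      then have kE: "k \<in> E" using g by (auto simp: E_def)
      \<comment> \<open>The remainder of \<open>k\<close> modulo \<open>n\<close> is again in
        \<open>E\<close> and below \<open>n\<close>, so it is 0 by minimality.\<close>
      define q where "q = k div int n"
      have "k - q * int n \<in> E" using E_diff[OF kE n(2)] .
      moreover have "k - q * int n = k mod int n" by (simp add: q_def minus_div_mult_eq_mod)
      ultimately have "int (nat (k mod int n)) \<in> E" using n(1) by simp
      moreover have "nat (k mod int n) < n"
        using n(1) pos_mod_bound[of "int n" k] pos_mod_sign[of "int n" k] by linarith
      ultimately have "nat (k mod int n) = 0" using n_least by blast
      moreover have "k mod int n \<ge> 0" using n(1) by simp
      ultimately have k0: "k - q * int n = 0" using \<open>k - q * int n = k mod int n\<close> by linarith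
      obtain m' where m': "m' \<in> M" "g \<otimes> t' [^] (- q) = m' \<otimes> t [^] (k - q * int n)"
        using red[OF m m0(1) t'_def, of q] by blast
      then have "g \<otimes> t' [^] (- q) = m'" using k0 MG by simp
      moreover from this have "m' \<in> K"
        using g subgroup.m_closed[OF K _ subgroup_int_pow_closed[OF K t'K]] by blast
      moreover have "g \<otimes> t' [^] (- q) \<otimes> t' [^] q = g"
        using gG t'G by (simp add: m_assoc int_pow_mult [symmetric])
      ultimately show "\<exists>m\<in>M \<inter> K. \<exists>k::int. g = m \<otimes> t' [^] k"
        using m'(1) by (intro bexI[of _ m'] exI[of _ q]) auto
    qed
    then show ?thesis by blast
  qed
qed

end

section \<open>Indexed series and their consequences\<close>

definition supersoluble_series :: "('a, 'b) monoid_scheme \<Rightarrow> (nat \<Rightarrow> 'a set) \<Rightarrow> nat \<Rightarrow> bool" where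
  "supersoluble_series G N n \<longleftrightarrow> N 0 = carrier G \<and> N n = {\<one>\<^bsub>G\<^esub>} \<and> (\<forall>i\<le>n. N i \<lhd> G) \<and>
     (\<forall>i<n. N (Suc i) \<subseteq> N i \<and> (\<exists>t. cyclic_modulo G (N (Suc i)) (N i) t))"

text \<open>Finds a jump along a series: below, from an infinite to a finite term, and from a
  non-central to a central one.\<close>

lemma ex_last_failure:
  assumes "\<not> Q 0" "Q n"
  shows "\<exists>i<n. \<not> Q i \<and> Q (Suc i)"
  using assms by (induction n) (auto intro: less_SucI)

context group
begin

lemma supersoluble_imp_series:
  assumes "supersoluble G"
  shows "\<exists>N n. supersoluble_series G N n"
proof -
  obtain Hs :: "'a set list" where Hs: "Hs \<noteq> []" "hd Hs = carrier G" "last Hs = {\<one>}"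
      "\<And>i. i < length Hs \<Longrightarrow> Hs ! i \<lhd> G"
      "\<And>i. Suc i < length Hs \<Longrightarrow> Hs ! Suc i \<subseteq> Hs ! i"
      "\<And>i. Suc i < length Hs \<Longrightarrow> cyclic_group ((G\<lparr>carrier := Hs ! i\<rparr>) Mod (Hs ! Suc i))"
    using assms unfolding supersoluble_def by blast
  have "supersoluble_series G (\<lambda>i. Hs ! i) (length Hs - 1)"
    unfolding supersoluble_series_def
  proof (intro conjI allI impI)
    show "Hs ! 0 = carrier G" "Hs ! (length Hs - 1) = {\<one>}"
      using Hs(1-3) by (simp_all add: hd_conv_nth last_conv_nth)
    fix i
    show "Hs ! i \<lhd> G" if "i \<le> length Hs - 1" using that Hs(1) by (intro Hs(4)) (metis Suc_pred' le_imp_less_Suc length_greater_0_conv One_nat_def)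
    show "Hs ! Suc i \<subseteq> Hs ! i" if "i < length Hs - 1" using that Hs(5) by simp
    show "\<exists>t. cyclic_modulo G (Hs ! Suc i) (Hs ! i) t" if "i < length Hs - 1"
      using that Hs(4)[of i] Hs(4)[of "Suc i"] Hs(5,6)[of i]
      by (intro cyclic_modulo_if_cyclic_factor) (auto intro: normal_imp_subgroup)
  qed
  then show ?thesis by blast
qed

text \<open>Supersoluble groups are polycyclic: walking up the series intersected with
  \<open>K\<close>, each step adds one generator.\<close>

lemma finitely_generated_subgroup:
  assumes S: "supersoluble_series G N n" and K: "subgroup K G"
  shows "\<exists>U. finite U \<and> U \<subseteq> K \<and> K = generate G U"
proof -
  have "\<exists>U. finite U \<and> U \<subseteq> N i \<inter> K \<and> N i \<inter> K = generate G U" if "i \<le> n" for i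
    using that
  proof (induction i rule: inc_induct)
    case base
    have "N n \<inter> K = {\<one>}" using S subgroup.one_closed[OF K] by (auto simp: supersoluble_series_def)
    then show ?case using generate_empty by auto
  next
    case (step i)
    then obtain U where U: "finite U" "U \<subseteq> N (Suc i) \<inter> K" "N (Suc i) \<inter> K = generate G U" by blast
    have nor: "N (Suc i) \<lhd> G" "N i \<lhd> G" "N (Suc i) \<subseteq> N i"
      using S step(2) by (auto simp: supersoluble_series_def)
    note sub = normal_imp_subgroup[OF nor(2)]
    obtain t0 where "cyclic_modulo G (N (Suc i)) (N i) t0"
      using S step(2) by (auto simp: supersoluble_series_def)
    from cyclic_modulo_Int[OF nor(1,3) sub K this]
    obtain t where t: "cyclic_modulo G (N (Suc i) \<inter> K) (N i \<inter> K) t" ..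
    have tK: "t \<in> N i \<inter> K" using t by (simp add: cyclic_modulo_def)
    have NK: "subgroup (N i \<inter> K) G" using subgroups_Inter_pair[OF sub K] .
    have tU: "insert t U \<subseteq> N i \<inter> K" using tK U(2) nor(3) by blast
    then have tUG: "insert t U \<subseteq> carrier G" using subgroup.subset[OF NK] by blast
    note gen = generate_is_subgroup[OF tUG]
    have "N i \<inter> K \<subseteq> generate G (insert t U)"
    proof
      fix g assume "g \<in> N i \<inter> K"
      then obtain m k where m: "m \<in> N (Suc i) \<inter> K" "g = m \<otimes> t [^] (k::int)"
        using t unfolding cyclic_modulo_def by blast
      have "m \<in> generate G (insert t U)"
        using m(1) U(3) mono_generate[of U "insert t U"] by blast
      moreover have "t \<in> generate G (insert t U)" by (simp add: generate.incl)
      ultimately show "g \<in> generate G (insert t U)"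
        unfolding m(2) using subgroup.m_closed[OF gen] subgroup_int_pow_closed[OF gen] by blast
    qed
    then have "N i \<inter> K = generate G (insert t U)"
      using generate_subgroup_incl[OF tU NK] by blast
    then show ?case using U(1) tU by (intro exI[of _ "insert t U"]) auto
  qed
  moreover have "N 0 \<inter> K = K" using S subgroup.subset[OF K] by (auto simp: supersoluble_series_def)
  ultimately show ?thesis by (metis le0)
qed

text \<open>Where the series jumps from an infinite term to a finite \<open>K\<close>, the infinite
  term is \<open>K<t>\<close> with \<open>t\<close> of infinite order. A power of \<open>t\<close>
  centralizes \<open>K\<close>, and a further power gets rid of the factors from \<open>K\<close>
  that appear in its conjugates.\<close>

lemma infinite_cyclic_normal_subgroup:
  assumes S: "supersoluble_series G N n" and inf: "infinite (carrier G)"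
  shows "\<exists>z\<in>carrier G. ord z = 0 \<and> (\<forall>g\<in>carrier G. \<exists>j::int. conj G z g = z [^] j)"
proof -
  have "\<not> finite (N 0)" "finite (N n)" using S inf by (auto simp: supersoluble_series_def)
  then obtain i where i: "i < n" "infinite (N i)" "finite (N (Suc i))"
    using ex_last_failure[of "\<lambda>i. finite (N i)"] by blast
  define K where "K = N (Suc i)"
  have nor: "K \<lhd> G" "N i \<lhd> G" and finK: "finite K" using S i by (auto simp: supersoluble_series_def K_def)
  obtain t where t: "cyclic_modulo G K (N i) t" using S i by (auto simp: supersoluble_series_def K_def)
  note Ksub = normal_imp_subgroup[OF nor(1)]
  note KG = subgroup.mem_carrier[OF Ksub]
  have tN: "t \<in> N i" using t by (simp add: cyclic_modulo_def)
  have tG: "t \<in> carrier G" using tN subgroup.mem_carrier[OF normal_imp_subgroup[OF nor(2)]] by blast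
  have ord_t: "ord t = 0"
  proof (rule ccontr)
    assume "ord t \<noteq> 0"
    then have "finite (generate G {t})"
      using tG finite_cyclic_subgroup_order[of t] by (simp add: carrier_subgroup_generated)
    moreover have "N i \<subseteq> (\<lambda>(m, u). m \<otimes> u) ` (K \<times> generate G {t})"
      using t tG by (force simp: cyclic_modulo_def generate_pow)
    ultimately show False using finK i(2) finite_subset by blast
  qed
  \<comment> \<open>There are only finitely many maps from \<open>K\<close> to itself, so two powers
    of \<open>t\<close> act alike on \<open>K\<close> and their quotient centralizes
    \<open>K\<close>.\<close>
  define f where "f l = restrict (\<lambda>a. conj G a (t [^] int l)) K" for l
  have "f l \<in> K \<rightarrow>\<^sub>E K" for l
    using normal_conj_closed[OF nor(1)] tG by (auto simp: f_def)
  then have "range f \<subseteq> K \<rightarrow>\<^sub>E K" by blast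
  then have "finite (range f)" using finite_PiE[of K "\<lambda>_. K"] finK finite_subset by blast
  then have "\<not> inj f" using finite_imageD by blast
  then obtain l l' where ll: "l < l'" "f l = f l'" by (metis injI linorder_neqE_nat)
  define m where "m = int l' - int l"
  have m: "m > 0" using ll by (simp add: m_def)
  define u where "u = t [^] m"
  have uG: "u \<in> carrier G" using tG by (simp add: u_def)
  have uK: "a \<otimes> u = u \<otimes> a" if a: "a \<in> K" for a
  proof -
    have aG: "a \<in> carrier G" using KG a .
    have "conj G a (t [^] int l) = conj G a (t [^] int l')"
      using ll(2) a by (auto simp: f_def fun_eq_iff restrict_def split: if_splits)
    then have "a = conj G (conj G a (t [^] int l')) (inv (t [^] int l))"
      using conj_conj_inv(1)[OF aG, of "t [^] int l"] tG by simp
    also have "\<dots> = conj G a u"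
      using aG tG by (simp add: conj_conj u_def m_def int_pow_diff)
    finally show ?thesis using conj_eq_self_iff[OF aG uG] by simp
  qed
  \<comment> \<open>A conjugate of \<open>u\<close> has the form \<open>\<kappa>' u^j\<close> with
    \<open>\<kappa>'\<close> in \<open>K\<close> commuting with \<open>u\<close>; the power
    \<open>card K\<close> kills \<open>\<kappa>'\<close>.\<close>
  define z where "z = u [^] int (card K)"
  have zG: "z \<in> carrier G" using uG by (simp add: z_def)
  have cK: "card K > 0" using finK subgroup.one_closed[OF Ksub] card_gt_0_iff by blast
  have "ord z = 0"
  proof (rule ccontr)
    assume "ord z \<noteq> 0"
    then have "t [^] (m * int (card K) * int (ord z)) = \<one>"
      using zG tG int_pow_eq_id[of z "int (ord z)"] by (simp add: z_def u_def int_pow_pow)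
    moreover have "m * int (card K) * int (ord z) \<noteq> 0" using m cK \<open>ord z \<noteq> 0\<close> by simp
    ultimately show False using ord_nonzero_if_int_pow_eq_one[OF tG] ord_t by blast
  qed
  moreover have "\<exists>j::int. conj G z g = z [^] j" if g: "g \<in> carrier G" for g
  proof -
    have "conj G t g \<in> N i" using normal_conj_closed[OF nor(2) tN g] .
    then obtain \<kappa> j where \<kappa>: "\<kappa> \<in> K" "conj G t g = \<kappa> \<otimes> t [^] (j::int)"
      using t unfolding cyclic_modulo_def by blast
    have "conj G u g = (\<kappa> \<otimes> t [^] j) [^] m"
      using tG g by (simp add: u_def conj_int_pow \<kappa>(2))
    then obtain \<kappa>' where \<kappa>': "\<kappa>' \<in> K" "conj G u g = \<kappa>' \<otimes> (t [^] j) [^] m"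
      using normal_mult_int_pow[OF nor(1) \<kappa>(1), of "t [^] j" m] tG by auto
    then have ug: "conj G u g = \<kappa>' \<otimes> u [^] j" using tG by (simp add: u_def int_pow_pow mult.commute)
    have comm: "\<kappa>' \<otimes> u [^] j = u [^] j \<otimes> \<kappa>'"
      using comm_int_pow_left[OF uG KG[OF \<kappa>'(1)]] uK[OF \<kappa>'(1)] by simp
    have "\<kappa>' [^] int (card K) = \<one>"
    proof -
      interpret K: group "G\<lparr>carrier := K\<rparr>" using subgroup.subgroup_is_group[OF Ksub is_group] .
      have "\<kappa>' [^]\<^bsub>G\<lparr>carrier := K\<rparr>\<^esub> order (G\<lparr>carrier := K\<rparr>) = \<one>"
        using K.pow_order_eq_1[of \<kappa>'] \<kappa>'(1) by simp
      then show ?thesis by (simp add: order_def int_pow_int nat_pow_def)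
    qed
    then have "conj G z g = z [^] j"
      using uG g KG[OF \<kappa>'(1)]
      by (simp add: z_def conj_int_pow ug int_pow_mult_distrib[OF comm] int_pow_pow mult.commute)
    then show ?thesis by blast
  qed
  ultimately show ?thesis using zG by blast
qed

section \<open>Centralizers of elements of infinite order\<close>

text \<open>A non-abelian centralizer \<open>C\<close> of \<open>w\<close>, intersected with the
  series, has a term that is cyclic modulo a subgroup central in \<open>C\<close> but is not itself
  central. Its generator \<open>b\<close> and some \<open>y\<close> in \<open>C\<close> then meet
  the assumptions of \<open>ord_nonzero_central_in_nonabelian\<close>.\<close>

lemma centralizer_abelian_if_infinite_order:
  assumes S: "supersoluble_series G N n"
    and P: "\<And>H. \<lbrakk>subgroup H G; \<not> comm_group (G\<lparr>carrier := H\<rparr>)\<rbrakk> \<Longrightarrow> centralizer G H \<subseteq> H"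
    and w: "w \<in> carrier G" "ord w = 0"
    and u: "u \<in> carrier G" "u \<otimes> w = w \<otimes> u" and v: "v \<in> carrier G" "v \<otimes> w = w \<otimes> v"
  shows "u \<otimes> v = v \<otimes> u"
proof (rule ccontr)
  assume uv: "u \<otimes> v \<noteq> v \<otimes> u"
  define C where "C = centralizer G {w}"
  have C: "subgroup C G" unfolding C_def using subgroup_centralizer w by simp
  note CG = subgroup.mem_carrier[OF C]
  have Cw: "g \<otimes> w = w \<otimes> g" if "g \<in> C" for g using that by (simp add: C_def centralizer_def)
  have "u \<in> C" "v \<in> C" using u v by (simp_all add: C_def centralizer_def)
  then have "\<not> N 0 \<inter> C \<subseteq> centralizer G C"
    using uv S u(1) by (auto simp: supersoluble_series_def centralizer_def)
  moreover have "N n \<inter> C \<subseteq> centralizer G C"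
    using S CG by (auto simp: supersoluble_series_def centralizer_def)
  ultimately obtain i where i: "i < n" "\<not> N i \<inter> C \<subseteq> centralizer G C" "N (Suc i) \<inter> C \<subseteq> centralizer G C"
    using ex_last_failure[of "\<lambda>i. N i \<inter> C \<subseteq> centralizer G C"] by blast
  have nor: "N (Suc i) \<lhd> G" "N i \<lhd> G" "N (Suc i) \<subseteq> N i"
    using S i by (auto simp: supersoluble_series_def)
  note sub = normal_imp_subgroup[OF nor(2)]
  have NC: "subgroup (N i \<inter> C) G" using subgroups_Inter_pair[OF sub C] .
  obtain t where "cyclic_modulo G (N (Suc i)) (N i) t"
    using S i(1) by (auto simp: supersoluble_series_def)
  from cyclic_modulo_Int[OF nor(1,3) sub C this]
  obtain b where b: "cyclic_modulo G (N (Suc i) \<inter> C) (N i \<inter> C) b" ..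
  have bC: "b \<in> N i \<inter> C" and rep: "\<And>g. g \<in> N i \<inter> C \<Longrightarrow> \<exists>m\<in>N (Suc i) \<inter> C. \<exists>k::int. g = m \<otimes> b [^] k"
    using b by (auto simp: cyclic_modulo_def)
  have bG: "b \<in> carrier G" using bC CG by blast
  have "b \<notin> centralizer G C"
  proof
    assume bZ: "b \<in> centralizer G C"
    have ZC: "subgroup (centralizer G C) G" using subgroup_centralizer subgroup.subset[OF C] by blast
    have "N i \<inter> C \<subseteq> centralizer G C"
    proof
      fix g assume "g \<in> N i \<inter> C"
      then obtain m k where "m \<in> N (Suc i) \<inter> C" "g = m \<otimes> b [^] (k::int)" using rep by blast
      then show "g \<in> centralizer G C"
        using i(3) subgroup.m_closed[OF ZC _ subgroup_int_pow_closed[OF ZC bZ]] by blast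
    qed
    then show False using i(2) by blast
  qed
  then obtain y where y: "y \<in> C" "b \<otimes> y \<noteq> y \<otimes> b" using bG by (auto simp: centralizer_def)
  have yG: "y \<in> carrier G" using y CG by blast
  have conj_NC: "conj G g x \<in> N i \<inter> C" if "g \<in> N i \<inter> C" "x \<in> C" for g x
    using that normal_conj_closed[OF nor(2)] CG subgroup.m_closed[OF C] subgroup.m_inv_closed[OF C]
    by (auto simp: conj_def)
  have D: "m \<in> carrier G" "m \<otimes> x = x \<otimes> m" if "m \<in> N (Suc i) \<inter> C" "x \<in> C" for m x
    using that i(3) by (auto simp: centralizer_def)
  obtain m k where m: "m \<in> N (Suc i) \<inter> C" "conj G b y = m \<otimes> b [^] (k::int)"
    using rep conj_NC[OF bC y(1)] by blast
  obtain m' k' where m': "m' \<in> N (Suc i) \<inter> C" "conj G b (inv y) = m' \<otimes> b [^] (k'::int)"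
    using rep conj_NC[OF bC subgroup.m_inv_closed[OF C y(1)]] by blast
  note mD = D(1)[OF m(1) y(1)] D(2)[OF m(1) y(1)]
  note mD' = D(1)[OF m'(1) y(1)] D(2)[OF m'(1) y(1)]
  \<comment> \<open>The commutator of \<open>b\<close> and \<open>y\<close>. It commutes with
    \<open>b\<close>, since \<open>b^y\<close> is a central element of \<open>C\<close> times a
    power of \<open>b\<close>.\<close>
  define c where "c = inv b \<otimes> conj G b y"
  have cG: "c \<in> carrier G" using bG yG by (simp add: c_def)
  have conj_b: "conj G b y = b \<otimes> c" using bG yG by (simp add: c_def m_assoc [symmetric])
  have "conj G b y \<otimes> b = b \<otimes> conj G b y"
    unfolding m(2) using mD(1) bG bC D(2)[OF m(1)] comm_int_pow_left[OF bG bG refl]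
    by (intro comm_mult_left) auto
  then have "c \<otimes> b = b \<otimes> c"
    unfolding c_def using bG yG by (intro comm_mult_left comm_inv_left) auto
  then have bc: "b \<otimes> c = c \<otimes> b" by simp
  have c1: "c \<noteq> \<one>"
    using y(2) conj_b conj_eq_self_iff[OF bG yG] bG by auto
  have mfix: "conj G m y = m" "conj G m' y = m'"
    using conj_eq_self_iff yG mD mD' by simp_all
  \<comment> \<open>Conjugating \<open>b^y = m b^k\<close> by \<open>y\<close> once more fixes the
    central \<open>m\<close> and turns \<open>b^k\<close> into \<open>b^k c^k\<close>; dividing by
    \<open>b^y\<close> leaves \<open>c^k\<close>.\<close>
  have conj_c: "conj G c y = c [^] k"
  proof -
    have "conj G c y = inv (conj G b y) \<otimes> conj G (m \<otimes> b [^] k) y"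
      using bG yG by (simp add: c_def conj_mult conj_inv flip: m(2))
    also have "conj G (m \<otimes> b [^] k) y = m \<otimes> b [^] k \<otimes> c [^] k"
      using bG yG cG mD(1)
      by (simp add: conj_mult conj_int_pow mfix conj_b int_pow_mult_distrib[OF bc] m_assoc)
    also have "inv (conj G b y) \<otimes> (m \<otimes> b [^] k \<otimes> c [^] k) = c [^] k"
    proof -
      have "inv (m \<otimes> b [^] k) \<otimes> ((m \<otimes> b [^] k) \<otimes> c [^] k) = c [^] k"
        using bG cG mD(1) by (simp add: m_assoc [symmetric]) (simp add: inv_mult_group m_assoc)
      then show ?thesis unfolding m(2) .
    qed
    finally show ?thesis .
  qed
  \<comment> \<open>The same computation one step earlier: it starts from the conjugate
    \<open>m' b^k'\<close> of \<open>b\<close> by \<open>inv y\<close>, which \<open>y\<close> takes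
    back to \<open>b\<close>.\<close>
  have conj_c': "conj G c (inv y) = c [^] k'"
  proof -
    have "b = conj G (m' \<otimes> b [^] k') y"
      using conj_conj_inv(2)[OF bG yG] by (simp add: m'(2))
    also have "\<dots> = m' \<otimes> b [^] k' \<otimes> c [^] k'"
      using bG yG cG mD'(1)
      by (simp add: conj_mult conj_int_pow mfix conj_b int_pow_mult_distrib[OF bc] m_assoc)
    finally have b_eq: "b = conj G b (inv y) \<otimes> c [^] k'" by (simp only: m'(2))
    have "conj G c (inv y) = inv (conj G b (inv y)) \<otimes> b"
      using bG yG by (simp add: c_def conj_mult conj_inv)
    also have "\<dots> = inv (conj G b (inv y)) \<otimes> (conj G b (inv y) \<otimes> c [^] k')"
      using b_eq by (rule arg_cong)
    also have "\<dots> = c [^] k'" using bG yG cG by (simp add: m_assoc [symmetric])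
    finally show ?thesis .
  qed
  \<comment> \<open>\<open>w\<close> centralizes every subgroup of \<open>C\<close>, so the
    self-centralizing hypothesis puts it into each non-abelian one.\<close>
  have "w \<in> generate G {b', y'}"
    if b': "b' \<in> generate G {b}" and y': "y' \<in> generate G {y}" and ne: "b' \<otimes> y' \<noteq> y' \<otimes> b'" for b' y'
  proof -
    have bCC: "generate G {b} \<subseteq> C" "generate G {y} \<subseteq> C"
      using generate_subgroup_incl[of "{b}" C] generate_subgroup_incl[of "{y}" C] C bC y by auto
    have sub: "{b', y'} \<subseteq> carrier G" using bCC b' y' CG by blast
    note gen = generate_is_subgroup[OF sub]
    have in_gen: "b' \<in> generate G {b', y'}" "y' \<in> generate G {b', y'}" by (auto intro: generate.incl)
    have "w \<otimes> s = s \<otimes> w" if "s \<in> {b', y'}" for s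
      using that Cw bCC b' y' by fastforce
    then have "w \<in> centralizer G (generate G {b', y'})"
      using comm_generate[OF sub w(1)] w(1) unfolding centralizer_def by blast
    moreover have "\<not> comm_group (G\<lparr>carrier := generate G {b', y'}\<rparr>)"
      using comm_group_subgroup_iff[OF gen] in_gen ne by blast
    ultimately show ?thesis using P[OF gen] by blast
  qed
  moreover have "w \<otimes> b = b \<otimes> w" "w \<otimes> y = y \<otimes> w" using Cw bC y by auto
  ultimately show False
    using ord_nonzero_central_in_nonabelian[OF bG cG yG w(1) bc conj_b c1 conj_c conj_c'] w(2) by blast
qed

end

section \<open>Finitely generated abelian groups\<close>

lemma list_all2_ex_right:
  assumes "list_all2 P xs ys" "x \<in> set xs"
  shows "\<exists>y\<in>set ys. P x y"
  using assms by (induction rule: list_all2_induct) auto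

text \<open>With \<open>list_all2\<close> instead of indices, the independence condition splits
  along \<open>Cons\<close> and append.\<close>

lemma cyclic_direct_product_iff:
  fixes G :: "('a, 'b) monoid_scheme"
  shows
  "cyclic_direct_product G A gs \<longleftrightarrow>
     set gs \<subseteq> carrier G \<and> A = generate G (set gs) \<and>
     (\<forall>u \<in> set gs. \<forall>v \<in> set gs. u \<otimes>\<^bsub>G\<^esub> v = v \<otimes>\<^bsub>G\<^esub> u) \<and>
     (\<forall>ys. list_all2 (\<lambda>y g. y \<in> generate G {g}) ys gs \<longrightarrow>
        foldr (\<otimes>\<^bsub>G\<^esub>) ys \<one>\<^bsub>G\<^esub> = \<one>\<^bsub>G\<^esub> \<longrightarrow> set ys \<subseteq> {\<one>\<^bsub>G\<^esub>})"
proof -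
  have 1: "list_all2 P ys gs \<longleftrightarrow> length ys = length gs \<and> (\<forall>i<length gs. P (ys ! i) (gs ! i))" for P and ys :: "'a list"
    by (auto simp: list_all2_conv_all_nth)
  have 2: "set ys \<subseteq> {\<one>\<^bsub>G\<^esub>} \<longleftrightarrow> (\<forall>i<length ys. ys ! i = \<one>\<^bsub>G\<^esub>)" for ys
    using all_set_conv_all_nth[of ys "\<lambda>y. y = \<one>\<^bsub>G\<^esub>"] by (simp add: subset_iff Ball_def)
  show ?thesis unfolding cyclic_direct_product_def 1 2 imp_conjL ..
qed

context group
begin

lemma foldr_mult_closed:
  "set ys \<subseteq> carrier G \<Longrightarrow> v \<in> carrier G \<Longrightarrow> foldr (\<otimes>) ys v \<in> carrier G"
  by (induction ys) auto

lemma foldr_mult_append: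
  assumes "set ys \<subseteq> carrier G" "v \<in> carrier G"
  shows "foldr (\<otimes>) ys v = foldr (\<otimes>) ys \<one> \<otimes> v"
  using assms by (induction ys) (auto simp: m_assoc foldr_mult_closed)

lemma generate_eqI:
  assumes "S \<subseteq> carrier G" "T \<subseteq> carrier G" "S \<subseteq> generate G T" "T \<subseteq> generate G S"
  shows "generate G S = generate G T"
  using assms generate_subgroup_incl generate_is_subgroup by (metis subset_antisym)

lemma generate_insert_cong:
  assumes "S \<subseteq> carrier G" "T \<subseteq> carrier G" "x \<in> carrier G" "generate G S = generate G T"
  shows "generate G (insert x S) = generate G (insert x T)"
proof (rule generate_eqI)
  have "S \<subseteq> generate G S" "T \<subseteq> generate G T" by (auto intro: generate.incl)
  moreover have "generate G S \<subseteq> generate G (insert x S)" "generate G T \<subseteq> generate G (insert x T)"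
    by (auto intro!: mono_generate)
  ultimately have "S \<subseteq> generate G (insert x T)" "T \<subseteq> generate G (insert x S)"
    using assms(4) by simp_all
  then show "insert x S \<subseteq> generate G (insert x T)" "insert x T \<subseteq> generate G (insert x S)"
    by (simp_all add: generate.incl)
qed (use assms in auto)

lemma generate_insert_generate:
  assumes "S \<subseteq> carrier G" "x \<in> carrier G"
  shows "generate G (insert x (generate G S)) = generate G (insert x S)"
proof (rule generate_insert_cong)
  show "generate G (generate G S) = generate G S"
    using generate_eqI[OF generate_incl[OF assms(1)] assms(1)] by (auto intro: generate.incl)
qed (use assms generate_incl in auto)

lemma ord_subgroup:
  assumes "subgroup H G" "a \<in> H"
  shows "group.ord (G\<lparr>carrier := H\<rparr>) a = ord a"
proof -
  interpret H: group "G\<lparr>carrier := H\<rparr>" using subgroup.subgroup_is_group[OF assms(1) is_group] .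
  have "a [^]\<^bsub>G\<lparr>carrier := H\<rparr>\<^esub> n = a [^] n" for n :: nat by (simp add: nat_pow_def)
  then show ?thesis
    using H.ord_unique[of a "ord a"] assms subgroup.mem_carrier[OF assms(1)] by (simp add: pow_eq_id)
qed

lemma ord_le_if_int_pow_eq_one:
  assumes "x \<in> carrier G" "x [^] (n::int) = \<one>" "n > 0"
  shows "ord x \<noteq> 0" "int (ord x) \<le> n"
  using assms ord_nonzero_if_int_pow_eq_one[of x n] int_pow_eq_id[of x n] zdvd_imp_le[of "int (ord x)" n]
  by simp_all

end

context comm_group
begin

section \<open>Changing generators of an abelian group\<close>

lemma generate_insert_eq:
  assumes S: "S \<subseteq> carrier G" and x: "x \<in> carrier G" and g: "g \<in> generate G (insert x S)"
  shows "\<exists>t\<in>generate G S. \<exists>l::int. g = x [^] l \<otimes> t"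
proof -
  note T = generate_is_subgroup[OF S]
  note TG = subgroup.mem_carrier[OF T]
  have "conj G t y = t" if "t \<in> generate G S" "y \<in> carrier G" for t y
    using that TG conj_eq_self_iff m_comm by blast
  moreover have "insert x S \<subseteq> insert x (generate G S)" using generate.incl by (auto intro: generate.incl)
  then have "g \<in> generate G (insert x (generate G S))"
    using g mono_generate by blast
  ultimately obtain t l where "t \<in> generate G S" "g = t \<otimes> x [^] (l::int)"
    using generate_insert_normalizing[OF T x] x by (metis inv_closed)
  then show ?thesis using m_comm TG x by (metis int_pow_closed)
qed

text \<open>Divided by its gcd, a nonzero \<open>(m, g)\<close> becomes primitive and is completed
  by Bezout to an integer matrix of determinant 1. The inverse matrix is integral as well, so
  \<open>x'\<close> and \<open>y'\<close> generate the same subgroup as \<open>x\<close> and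
  \<open>y\<close>.\<close>

lemma generate_pair_bezout:
  fixes m g :: int
  assumes x: "x \<in> carrier G" and y: "y \<in> carrier G"
  shows "\<exists>x'\<in>carrier G. \<exists>y'\<in>carrier G. x [^] m \<otimes> y [^] g = x' [^] gcd m g \<and>
    (\<forall>S\<subseteq>carrier G. generate G (insert x' (insert y' S)) = generate G (insert x (insert y S)))"
proof (cases "m = 0 \<and> g = 0")
  case True
  then show ?thesis using x y by (intro bexI[of _ x] bexI[of _ y]) auto
next
  case False
  define d where "d = gcd m g"
  have d: "d \<noteq> 0" using False by (simp add: d_def)
  define m' g' where "m' = m div d" and "g' = g div d"
  have m: "m = m' * d" and g: "g = g' * d" by (simp_all add: m'_def g'_def d_def)
  obtain u v where "u * m + v * g = d" using bezout_int[of m g] by (auto simp: d_def)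
  then have "d * (u * m' + v * g') = d * 1" by (simp add: m g algebra_simps)
  then have uv: "u * m' + v * g' = 1" using d mult_left_cancel by blast
  note pow = comm_pair_int_pow[OF x y m_comm[OF x y]]
  note mul = comm_pair_mult[OF x y m_comm[OF x y]]
  define x' y' where "x' = x [^] m' \<otimes> y [^] g'" and "y' = x [^] (- v) \<otimes> y [^] u"
  have carr: "x' \<in> carrier G" "y' \<in> carrier G" using x y by (simp_all add: x'_def y'_def)
  have "x [^] m \<otimes> y [^] g = x' [^] d" by (simp add: x'_def pow m g)
  \<comment> \<open>The entries \<open>u\<close>, \<open>- g'\<close>, \<open>v\<close>,
    \<open>m'\<close> are those of the inverse matrix.\<close>
  moreover have x_eq: "x = x' [^] u \<otimes> y' [^] (- g')"
    using x y uv unfolding x'_def y'_def pow mul by (simp add: algebra_simps)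
  have y_eq: "y = x' [^] v \<otimes> y' [^] m'"
    using x y uv unfolding x'_def y'_def pow mul by (simp add: algebra_simps)
  have "generate G (insert x' (insert y' S)) = generate G (insert x (insert y S))" if S: "S \<subseteq> carrier G" for S
  proof (rule generate_eqI)
    have 1: "insert x' (insert y' S) \<subseteq> carrier G" "insert x (insert y S) \<subseteq> carrier G"
      using carr x y S by auto
    then show "insert x' (insert y' S) \<subseteq> carrier G" "insert x (insert y S) \<subseteq> carrier G" .
    note sub = generate_is_subgroup[OF 1(1)] generate_is_subgroup[OF 1(2)]
    note cl = subgroup.m_closed[OF sub(1)] subgroup_int_pow_closed[OF sub(1)]
      subgroup.m_closed[OF sub(2)] subgroup_int_pow_closed[OF sub(2)]
    have "x \<in> generate G (insert x (insert y S))" "y \<in> generate G (insert x (insert y S))"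
      by (auto intro: generate.incl)
    then have "x' \<in> generate G (insert x (insert y S))" "y' \<in> generate G (insert x (insert y S))"
      unfolding x'_def y'_def by (auto intro: cl)
    then show "insert x' (insert y' S) \<subseteq> generate G (insert x (insert y S))"
      by (auto intro: generate.incl)
    have "x' \<in> generate G (insert x' (insert y' S))" "y' \<in> generate G (insert x' (insert y' S))"
      by (auto intro: generate.incl)
    then have "x' [^] u \<otimes> y' [^] (- g') \<in> generate G (insert x' (insert y' S))"
      "x' [^] v \<otimes> y' [^] m' \<in> generate G (insert x' (insert y' S))"
      by (auto intro: cl)
    then show "insert x (insert y S) \<subseteq> generate G (insert x' (insert y' S))"
      unfolding x_eq [symmetric] y_eq [symmetric] by (auto intro: generate.incl)
  qed
  ultimately show ?thesis using carr unfolding d_def [symmetric] by blast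
qed

text \<open>By induction the part of \<open>w\<close> in the span of the tail is a power of one
  generator there; \<open>generate_pair_bezout\<close> merges it with the power of
  \<open>x\<close>.\<close>

lemma generate_power_of_head:
  assumes "xs \<noteq> []" "set xs \<subseteq> carrier G" "w \<in> generate G (set xs)"
  shows "\<exists>y ys. length (y # ys) = length xs \<and> set (y # ys) \<subseteq> carrier G \<and>
    generate G (set (y # ys)) = generate G (set xs) \<and> (\<exists>g::int. w = y [^] g)"
  using assms
proof (induction xs arbitrary: w)
  case (Cons x xs)
  show ?case
  proof (cases "xs = []")
    case True
    then show ?thesis using Cons.prems by (intro exI[of _ x] exI[of _ "[]"]) (auto simp: generate_pow)
  next
    case False
    have x: "x \<in> carrier G" and xs: "set xs \<subseteq> carrier G" using Cons.prems by auto
    obtain t l where t: "t \<in> generate G (set xs)" "w = x [^] (l::int) \<otimes> t"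
      using generate_insert_eq[OF xs x, of w] Cons.prems(3) by auto
    obtain y ys g where y: "length (y # ys) = length xs" "set (y # ys) \<subseteq> carrier G"
      "generate G (set (y # ys)) = generate G (set xs)" "t = y [^] (g::int)"
      using Cons.IH[OF False xs t(1)] by blast
    have yG: "y \<in> carrier G" "set ys \<subseteq> carrier G" using y(2) by auto
    obtain x' y' where x': "x' \<in> carrier G" "y' \<in> carrier G" "w = x' [^] gcd l g"
      and gen: "\<And>S. S \<subseteq> carrier G \<Longrightarrow> generate G (insert x' (insert y' S)) = generate G (insert x (insert y S))"
      using generate_pair_bezout[OF x yG(1), of l g] unfolding t(2) y(4) by blast
    have "generate G (set (x' # y' # ys)) = generate G (insert x (set (y # ys)))"
      using gen[OF yG(2)] by simp
    also have "\<dots> = generate G (insert x (set xs))"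
      by (rule generate_insert_cong[OF y(2) xs x y(3)])
    finally show ?thesis using x' yG y(1)
      by (intro exI[of _ x'] exI[of _ "y' # ys"]) auto
  qed
qed simp

text \<open>The exchange step of Rado's proof of the basis theorem.\<close>

lemma generating_list_exchange:
  assumes carr: "set (x # xs) \<subseteq> carrier G"
    and t: "t \<in> generate G {x}" "t \<in> generate G (set xs)" "t \<noteq> \<one>"
  shows "\<exists>x' xs'. length xs' = length xs \<and> set (x' # xs') \<subseteq> carrier G \<and>
    generate G (set (x' # xs')) = generate G (set (x # xs)) \<and> ord x' \<noteq> 0 \<and> (ord x = 0 \<or> ord x' < ord x)"
proof -
  have x: "x \<in> carrier G" and xs: "set xs \<subseteq> carrier G" using carr by auto
  have ne: "xs \<noteq> []"
  proof
    assume "xs = []"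
    then show False using t(2,3) generate_empty by simp
  qed
  obtain k :: int where k: "t = x [^] k" using t(1) x by (auto simp: generate_pow)
  \<comment> \<open>For finite \<open>ord x\<close> the exponent is reduced to lie strictly between
    0 and \<open>ord x\<close>; this is what makes the order drop.\<close>
  obtain m :: int where m: "t = x [^] m" "m \<noteq> 0" "ord x = 0 \<or> (0 < m \<and> m < int (ord x))"
  proof (cases "ord x = 0")
    case True
    have "k \<noteq> 0" using t(3) k by auto
    then show ?thesis using that[OF k] True by blast
  next
    case False
    have "x [^] k = x [^] (k mod int (ord x))"
      using int_pow_eq[OF x, of k "k mod int (ord x)"] by (simp add: mod_eq_dvd_iff [symmetric])
    moreover have "k mod int (ord x) \<ge> 0" "k mod int (ord x) < int (ord x)" using False by simp_all
    moreover have "k mod int (ord x) \<noteq> 0" using calculation(1) k t(3) by auto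
    ultimately show ?thesis using that[of "k mod int (ord x)"] k by auto
  qed
  have "inv t \<in> generate G (set xs)" using generate_m_inv_closed[OF xs t(2)] .
  then obtain y ys g where y: "length (y # ys) = length xs" "set (y # ys) \<subseteq> carrier G"
      "generate G (set (y # ys)) = generate G (set xs)" "inv t = y [^] (g::int)"
    using generate_power_of_head[OF ne xs] by blast
  have yG: "y \<in> carrier G" "set ys \<subseteq> carrier G" using y(2) by auto
  obtain x' y' where x': "x' \<in> carrier G" "y' \<in> carrier G" "x [^] m \<otimes> y [^] g = x' [^] gcd m g"
      and gen: "\<And>S. S \<subseteq> carrier G \<Longrightarrow> generate G (insert x' (insert y' S)) = generate G (insert x (insert y S))"
    using generate_pair_bezout[OF x yG(1), of m g] by blast
  have "generate G (set (x' # y' # ys)) = generate G (set (x # y # ys))"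
    using gen[OF yG(2)] by simp
  also have "\<dots> = generate G (set (x # xs))"
    using generate_insert_cong[OF y(2) xs x y(3)] by simp
  finally have gen': "generate G (set (x' # y' # ys)) = generate G (set (x # xs))" .
  \<comment> \<open>\<open>x^m\<close> is \<open>t\<close> and \<open>y^g\<close> is
    \<open>inv t\<close>, so they cancel; hence the order of \<open>x'\<close> is at most
    \<open>gcd m g\<close>.\<close>
  have "x' [^] gcd m g = \<one>"
    using x' t x unfolding y(4) [symmetric] m(1) [symmetric] k by (metis int_pow_closed r_inv)
  moreover have "gcd m g > 0" using m(2) by simp
  ultimately have "ord x' \<noteq> 0" "int (ord x') \<le> gcd m g" using ord_le_if_int_pow_eq_one[OF x'(1)] by blast+
  moreover have "gcd m g \<le> m" if "0 < m" using that gcd_le1_int by blast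
  ultimately have "ord x' \<noteq> 0 \<and> (ord x = 0 \<or> ord x' < ord x)" using m(3) by linarith
  then show ?thesis using gen' x' yG y(1) by (intro exI[of _ x'] exI[of _ "y' # ys"]) auto
qed

text \<open>Among the generating lists of this length, take one whose head has least order. A
  nontrivial common element of \<open><x>\<close> and \<open><xs>\<close> would let the exchange
  step produce a head of smaller order.\<close>

lemma generating_list_split:
  assumes "set L \<subseteq> carrier G" "length L = Suc k"
  shows "\<exists>x xs. length xs = k \<and> set (x # xs) \<subseteq> carrier G \<and> generate G (set (x # xs)) = generate G (set L) \<and>
    generate G {x} \<inter> generate G (set xs) = {\<one>}"
proof -
  define good where "good L' \<longleftrightarrow> set L' \<subseteq> carrier G \<and> length L' = Suc k \<and> generate G (set L') = generate G (set L)" for L'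
  have L: "good L" using assms by (simp add: good_def)
  \<comment> \<open>As \<open>ord\<close> encodes infinite order by 0, minimality has to treat 0 as
    the largest value; if no head has finite order, any list will do.\<close>
  have "\<exists>M. good M \<and> (\<forall>M'. good M' \<longrightarrow> ord (hd M') \<noteq> 0 \<longrightarrow> ord (hd M) \<noteq> 0 \<and> ord (hd M) \<le> ord (hd M'))"
  proof (cases "\<exists>M. good M \<and> ord (hd M) \<noteq> 0")
    case True
    then obtain M where "good M \<and> ord (hd M) \<noteq> 0"
      "\<forall>M'. good M' \<and> ord (hd M') \<noteq> 0 \<longrightarrow> ord (hd M) \<le> ord (hd M')"
      using ex_has_least_nat[of "\<lambda>M. good M \<and> ord (hd M) \<noteq> 0" _ "\<lambda>M. ord (hd M)"] by blast
    then show ?thesis by blast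
  qed (use L in blast)
  then obtain M where M: "good M"
    "\<And>M'. good M' \<Longrightarrow> ord (hd M') \<noteq> 0 \<Longrightarrow> ord (hd M) \<noteq> 0 \<and> ord (hd M) \<le> ord (hd M')" by blast
  obtain x xs where xs: "M = x # xs" using M(1) by (cases M) (auto simp: good_def)
  have carr: "set (x # xs) \<subseteq> carrier G" using M(1) by (simp add: good_def xs)
  have "t = \<one>" if t: "t \<in> generate G {x}" "t \<in> generate G (set xs)" for t
  proof (rule ccontr)
    assume "t \<noteq> \<one>"
    from generating_list_exchange[OF carr t this] obtain x' xs' where
      *: "length xs' = length xs" "set (x' # xs') \<subseteq> carrier G"
      "generate G (set (x' # xs')) = generate G (set (x # xs))" "ord x' \<noteq> 0" "ord x = 0 \<or> ord x' < ord x"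
      by blast
    then have "good (x' # xs')" using M(1) by (simp add: good_def xs)
    then show False using M(2)[of "x' # xs'"] * by (auto simp: xs)
  qed
  moreover have "\<one> \<in> generate G {x}" "\<one> \<in> generate G (set xs)" by (auto intro: generate.one)
  ultimately have "generate G {x} \<inter> generate G (set xs) = {\<one>}" by blast
  moreover have "length xs = k" "generate G (set (x # xs)) = generate G (set L)"
    using M(1) by (simp_all add: good_def xs)
  ultimately show ?thesis using carr by blast
qed

section \<open>Direct products of cyclic groups with a single involution\<close>

lemma cyclic_direct_product_Cons:
  assumes gs: "cyclic_direct_product G A gs" and x: "x \<in> carrier G" and int: "generate G {x} \<inter> A = {\<one>}"
  shows "cyclic_direct_product G (generate G (insert x A)) (x # gs)"
proof -
  have carr: "set gs \<subseteq> carrier G" and A: "A = generate G (set gs)"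
    and ind: "\<And>ys. list_all2 (\<lambda>y g. y \<in> generate G {g}) ys gs \<Longrightarrow> foldr (\<otimes>) ys \<one> = \<one> \<Longrightarrow> set ys \<subseteq> {\<one>}"
    using gs by (auto simp: cyclic_direct_product_iff)
  note sub = generate_is_subgroup[OF carr]
  have AG: "A \<subseteq> carrier G" using A subgroup.subset[OF sub] by simp
  have "generate G (insert x A) = generate G (set (x # gs))"
    unfolding A using generate_insert_generate[OF carr x] by simp
  moreover have "set ys \<subseteq> {\<one>}"
    if ys: "list_all2 (\<lambda>y g. y \<in> generate G {g}) ys (x # gs)" "foldr (\<otimes>) ys \<one> = \<one>" for ys
  proof -
    obtain u zs where u: "ys = u # zs" "u \<in> generate G {x}" "list_all2 (\<lambda>y g. y \<in> generate G {g}) zs gs"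
      using ys(1) by (auto simp: list_all2_Cons2)
    \<comment> \<open>Stated for lists \<open>hs\<close> with entries from \<open>gs\<close>, so
      that the induction can pass to tails while \<open>A\<close> stays fixed.\<close>
    have zsA: "foldr (\<otimes>) zs \<one> \<in> A" if "list_all2 (\<lambda>y g. y \<in> generate G {g}) zs hs" "set hs \<subseteq> set gs" for zs hs
      using that
    proof (induction zs arbitrary: hs)
      case Nil
      then show ?case unfolding A by (simp add: generate.one)
    next
      case (Cons z zs)
      then obtain h hs' where h: "hs = h # hs'" "z \<in> generate G {h}" by (auto simp: list_all2_Cons1)
      then have "z \<in> A" unfolding A using mono_generate[of "{h}" "set gs"] Cons.prems(2) by auto
      moreover have "foldr (\<otimes>) zs \<one> \<in> A" using Cons h by auto
      ultimately show ?case using subgroup.m_closed[OF sub] A by simp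
    qed
    have fA: "foldr (\<otimes>) zs \<one> \<in> A" using zsA[OF u(3)] by simp
    have uG: "u \<in> carrier G" using u(2) generate_in_carrier[of "{x}"] x by blast
    have eq: "u \<otimes> foldr (\<otimes>) zs \<one> = \<one>" using ys(2) u(1) by simp
    then have "u = inv (foldr (\<otimes>) zs \<one>)" using inv_equality[OF eq] uG fA AG by auto
    then have "u \<in> A" using subgroup.m_inv_closed[OF sub] fA A by simp
    then have u1: "u = \<one>" using int u(2) by blast
    then have "foldr (\<otimes>) zs \<one> = \<one>" using eq fA AG by auto
    then show ?thesis using ind[OF u(3)] u1 u(1) by simp
  qed
  ultimately show ?thesis
    using x carr m_comm unfolding cyclic_direct_product_iff by (auto simp: subset_iff)
qed

text \<open>By the Chinese remainder theorem \<open><x>\<close> is the product of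
  \<open><x^p>\<close> and \<open><x^q>\<close>, of orders \<open>q\<close> and \<open>p\<close>.
  The second factor takes the last place, held by the trivial element before.\<close>

lemma cyclic_direct_product_coprime_split:
  fixes p q :: nat
  assumes gs: "cyclic_direct_product G A (x # as @ [\<one>])" and ord: "ord x = p * q" and pq: "coprime p q"
  shows "cyclic_direct_product G A ((x [^] p) # as @ [x [^] q])"
proof -
  have carr: "x \<in> carrier G" "set as \<subseteq> carrier G" and A: "A = generate G (set (x # as @ [\<one>]))"
    and ind: "\<And>ys. list_all2 (\<lambda>y g. y \<in> generate G {g}) ys (x # as @ [\<one>]) \<Longrightarrow> foldr (\<otimes>) ys \<one> = \<one> \<Longrightarrow> set ys \<subseteq> {\<one>}"
    using gs by (auto simp: cyclic_direct_product_iff)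
  let ?L = "(x [^] p) # as @ [x [^] q]"
  have L: "set ?L \<subseteq> carrier G" using carr by simp
  have L0: "set (x # as @ [\<one>]) \<subseteq> carrier G" using carr by simp
  note sub = generate_is_subgroup[OF L] and sub0 = generate_is_subgroup[OF L0]
  have "A = generate G (set ?L)"
    unfolding A
  proof (rule generate_eqI)
    obtain u v where "u * int p + v * int q = 1"
      using bezout_int[of "int p" "int q"] pq by auto
    then have "x = x [^] (int p * u + int q * v)" using carr by (simp add: mult.commute)
    also have "\<dots> = (x [^] p) [^] u \<otimes> (x [^] q) [^] v"
      using carr by (simp add: int_pow_mult int_pow_pow flip: int_pow_int)
    also have "\<dots> \<in> generate G (set ?L)"
      by (intro subgroup.m_closed[OF sub] subgroup_int_pow_closed[OF sub] generate.incl) auto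
    finally show "set (x # as @ [\<one>]) \<subseteq> generate G (set ?L)"
      by (auto intro: generate.incl generate.one)
    have "x [^] int k \<in> generate G (set (x # as @ [\<one>]))" for k
      by (intro subgroup_int_pow_closed[OF sub0] generate.incl) auto
    then show "set ?L \<subseteq> generate G (set (x # as @ [\<one>]))"
      unfolding int_pow_int by (auto intro: generate.incl)
  qed (fact L L0)+
  moreover have "set ys \<subseteq> {\<one>}"
    if ys: "list_all2 (\<lambda>y g. y \<in> generate G {g}) ys ?L" "foldr (\<otimes>) ys \<one> = \<one>" for ys
  proof -
    obtain u zs v where u: "ys = u # zs @ [v]" "u \<in> generate G {x [^] p}"
      "list_all2 (\<lambda>y g. y \<in> generate G {g}) zs as" "v \<in> generate G {x [^] q}"
      using ys(1) by (auto simp: list_all2_Cons2 list_all2_append2)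
    obtain i j :: int where ij: "u = x [^] (int p * i)" "v = x [^] (int q * j)"
      using u(2,4) carr by (auto simp: generate_pow int_pow_pow simp flip: int_pow_int)
    have uG: "u \<in> carrier G" "v \<in> carrier G" using carr ij by simp_all
    have zsG: "set zs \<subseteq> carrier G"
    proof
      fix z assume "z \<in> set zs"
      then obtain a where "a \<in> set as" "z \<in> generate G {a}"
        using list_all2_ex_right[OF u(3)] by blast
      then show "z \<in> carrier G" using generate_in_carrier[of "{a}"] carr by auto
    qed
    have "foldr (\<otimes>) ys \<one> = u \<otimes> (foldr (\<otimes>) zs \<one> \<otimes> v)"
      using foldr_mult_append[OF zsG uG(2)] uG by (simp add: u(1))
    \<comment> \<open>Both \<open>u\<close> and \<open>v\<close> lie in \<open><x>\<close>; merged
      into the first place they give a relation between the old generators.\<close>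
    also have "\<dots> = foldr (\<otimes>) ((u \<otimes> v) # zs @ [\<one>]) \<one>"
      using uG foldr_mult_closed[OF zsG one_closed] by (simp add: m_ac)
    finally have "foldr (\<otimes>) ((u \<otimes> v) # zs @ [\<one>]) \<one> = \<one>" using ys(2) by simp
    moreover have uv: "u \<otimes> v = x [^] (int p * i + int q * j)" using carr ij by (simp add: int_pow_mult)
    then have "list_all2 (\<lambda>y g. y \<in> generate G {g}) ((u \<otimes> v) # zs @ [\<one>]) (x # as @ [\<one>])"
      using u(3) carr by (auto simp: generate_pow intro!: list_all2_appendI)
    ultimately have "set ((u \<otimes> v) # zs @ [\<one>]) \<subseteq> {\<one>}" using ind by blast
    then have uv1: "u \<otimes> v = \<one>" and zs1: "set zs \<subseteq> {\<one>}" by auto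
    \<comment> \<open>Modulo \<open>q\<close> and modulo \<open>p\<close> this leaves one summand
      each; by coprimality \<open>q\<close> divides \<open>i\<close> and \<open>p\<close> divides
      \<open>j\<close>, so \<open>u\<close> and \<open>v\<close> are both trivial.\<close>
    have dvd: "int (p * q) dvd int p * i + int q * j"
      using uv1 carr int_pow_eq_id ord unfolding uv by metis
    then have "int q dvd int p * i + int q * j" "int p dvd int p * i + int q * j"
      by (metis dvd_trans of_nat_mult dvd_triv_right, metis dvd_trans of_nat_mult dvd_triv_left)
    then have "int q dvd int p * i" "int p dvd int q * j"
      by (simp_all add: dvd_add_left_iff dvd_add_right_iff)
    then have "int q dvd i" "int p dvd j"
      using pq by (simp_all add: coprime_dvd_mult_right_iff coprime_commute)
    then have "int (ord x) dvd int p * i" "int (ord x) dvd int q * j"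
      by (simp_all add: ord mult.commute[of "int p" "int q"] mult_dvd_mono) 
    then have "u = \<one>" "v = \<one>" using carr by (simp_all add: ij int_pow_eq_id)
    then show ?thesis using zs1 u(1) by auto
  qed
  ultimately show ?thesis using L m_comm unfolding cyclic_direct_product_iff by (auto simp: subset_iff)
qed

text \<open>Split off a cyclic factor \<open><x>\<close> and use induction on the rest. If
  \<open>ord x\<close> is finite and even, the only involution lies in \<open><x>\<close>, so the
  2-part \<open>d\<close> of the rest is trivial and the 2-part of \<open>x\<close> can take its
  place.\<close>

lemma cyclic_direct_product_single_involution:
  assumes "set L \<subseteq> carrier G"
    and "\<And>e f. \<lbrakk>e \<in> generate G (set L); f \<in> generate G (set L); e \<noteq> \<one>; f \<noteq> \<one>; e \<otimes> e = \<one>; f \<otimes> f = \<one>\<rbrakk> \<Longrightarrow> e = f"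
  shows "\<exists>as d h. cyclic_direct_product G (generate G (set L)) (as @ [d]) \<and>
    (\<forall>a\<in>set as. ord a = 0 \<or> odd (ord a)) \<and> ord d = 2 ^ h"
  using assms
proof (induction "length L" arbitrary: L)
  case 0
  have "list_all2 (\<lambda>y g. y \<in> generate G {g}) ys [\<one>] \<Longrightarrow> set ys \<subseteq> {\<one>}" for ys
    by (auto simp: list_all2_Cons2 generate_one)
  then have "cyclic_direct_product G (generate G (set L)) ([] @ [\<one>])"
    using 0 by (simp add: cyclic_direct_product_iff generate_one generate_empty)
  moreover have "ord \<one> = 2 ^ 0" by simp
  ultimately show ?case by (metis empty_iff list.set(1))
next
  case (Suc k)
  obtain x xs where xs: "length xs = k" "set (x # xs) \<subseteq> carrier G"
    "generate G (set (x # xs)) = generate G (set L)" and int: "generate G {x} \<inter> generate G (set xs) = {\<one>}"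
    using generating_list_split[OF Suc.prems(1) Suc.hyps(2)[symmetric]] by blast
  have xG: "x \<in> carrier G" and xsG: "set xs \<subseteq> carrier G" using xs(2) by auto
  let ?A = "generate G (set L)" and ?B = "generate G (set xs)"
  have BA: "?B \<subseteq> ?A" and xA: "generate G {x} \<subseteq> ?A"
    unfolding xs(3) [symmetric] by (auto intro!: mono_generate)
  obtain as d h where IH: "cyclic_direct_product G ?B (as @ [d])"
    "\<forall>a\<in>set as. ord a = 0 \<or> odd (ord a)" "ord d = 2 ^ h"
    using Suc.hyps(1)[of xs] xs(1) xsG Suc.prems(2) BA by blast
  have "generate G (insert x ?B) = ?A"
    unfolding xs(3) [symmetric] using generate_insert_generate[OF xsG xG] by simp
  then have cdp: "cyclic_direct_product G ?A (x # as @ [d])"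
    using cyclic_direct_product_Cons[OF IH(1) xG int] by simp
  show ?case
  proof (cases "ord x = 0 \<or> odd (ord x)")
    case True
    then show ?thesis using cdp IH by (intro exI[of _ "x # as"] exI[of _ d] exI[of _ h]) auto
  next
    case False
    then have ord_x: "ord x \<noteq> 0" "even (ord x)" by auto
    obtain m where "ord x = 2 ^ multiplicity 2 (ord x) * m" "odd m"
      by (rule multiplicity_decompose'[of "ord x" 2]) (use ord_x(1) in auto)
    then obtain e where em: "ord x = 2 ^ e * m" "odd m" by blast
    have dG: "d \<in> carrier G" using IH(1) by (auto simp: cyclic_direct_product_iff)
    have invol: "g [^] (n div 2) \<noteq> \<one>" "g [^] (n div 2) \<otimes> g [^] (n div 2) = \<one>"
      if "g \<in> carrier G" "ord g = n" "even n" "n \<noteq> 0" for g n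
    proof -
      have "\<not> n dvd n div 2" using that(3,4) by (auto dest: dvd_imp_le)
      then show "g [^] (n div 2) \<noteq> \<one>" using that pow_eq_id by blast
      have "n div 2 + n div 2 = n" using that(3) by auto
      then show "g [^] (n div 2) \<otimes> g [^] (n div 2) = \<one>" using that by (metis nat_pow_mult pow_ord_eq_1)
    qed
    \<comment> \<open>Otherwise \<open><x>\<close> and \<open><d>\<close> would share the only
      involution, although \<open><x>\<close> meets the rest trivially.\<close>
    have "h = 0"
    proof (rule ccontr)
      assume "h \<noteq> 0"
      then have ev: "even (ord d)" "ord d \<noteq> 0" using IH(3) by auto
      let ?e = "x [^] (ord x div 2)" and ?f = "d [^] (ord d div 2)"
      have e: "?e \<in> generate G {x}" using xG by (auto simp: generate_pow simp flip: int_pow_int)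
      have "?B = generate G (set (as @ [d]))" using IH(1) unfolding cyclic_direct_product_iff by blast
      moreover have "d \<in> generate G (set (as @ [d]))" by (simp add: generate.incl)
      ultimately have "d \<in> ?B" by blast
      then have f: "?f \<in> ?B"
        using subgroup_int_pow_closed[OF generate_is_subgroup[OF xsG], of d "int (ord d div 2)"]
        by (simp only: int_pow_int)
      have "?e = ?f"
        by (rule Suc.prems(2)[OF subsetD[OF xA e] subsetD[OF BA f]
              invol(1)[OF xG refl ord_x(2,1)] invol(1)[OF dG refl ev]
              invol(2)[OF xG refl ord_x(2,1)] invol(2)[OF dG refl ev]])
      with e f have "?e \<in> generate G {x} \<inter> ?B" by simp
      then have "?e = \<one>" unfolding int by (rule singletonD)
      then show False using invol(1)[OF xG refl ord_x(2,1)] by contradiction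
    qed
    then have "d = \<one>" using IH(3) ord_eq_1[OF dG] by simp
    then have "cyclic_direct_product G ?A ((x [^] (2 ^ e :: nat)) # as @ [x [^] m])"
      using cyclic_direct_product_coprime_split[of ?A x as "2 ^ e" m] cdp em by simp
    moreover have "ord (x [^] (2 ^ e :: nat)) = m" "ord (x [^] m) = 2 ^ e"
      using ord_pow[OF xG, of "2 ^ e"] ord_pow[OF xG, of m] em ord_x(1) by simp_all
    ultimately show ?thesis using IH(2) em(2)
      by (intro exI[of _ "(x [^] (2 ^ e :: nat)) # as"] exI[of _ "x [^] m"] exI[of _ e]) auto
  qed
qed

end

text \<open>Transfers the decomposition from \<open>A\<close> as a group of its own to
  \<open>G\<close>; generated subgroups and orders are the same in both.\<close>

lemma (in group) abelian_subgroup_decomposition: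
  assumes A: "subgroup A G" "comm_group (G\<lparr>carrier := A\<rparr>)"
    and fin: "finite U" "U \<subseteq> A" "A = generate G U"
    and inv: "\<And>e f. \<lbrakk>e \<in> A; f \<in> A; e \<noteq> \<one>; f \<noteq> \<one>; e \<otimes> e = \<one>; f \<otimes> f = \<one>\<rbrakk> \<Longrightarrow> e = f"
  shows "\<exists>as d h. cyclic_direct_product G A (as @ [d]) \<and>
    (\<forall>a\<in>set as. ord a = 0 \<or> odd (ord a)) \<and> ord d = 2 ^ h"
proof -
  interpret A: comm_group "G\<lparr>carrier := A\<rparr>" by (fact A)
  obtain L where L: "U = set L" using fin(1) finite_list by blast
  have gen: "generate (G\<lparr>carrier := A\<rparr>) S = generate G S" if "S \<subseteq> A" for S
    using generate_consistent[OF that A(1)] by simp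
  have genL: "generate (G\<lparr>carrier := A\<rparr>) (set L) = A"
    using gen[of "set L"] fin(2,3) unfolding L by blast
  have "\<exists>as d h. cyclic_direct_product (G\<lparr>carrier := A\<rparr>) (generate (G\<lparr>carrier := A\<rparr>) (set L)) (as @ [d]) \<and>
      (\<forall>a\<in>set as. A.ord a = 0 \<or> odd (A.ord a)) \<and> A.ord d = 2 ^ h"
  proof (rule A.cyclic_direct_product_single_involution)
    show "set L \<subseteq> carrier (G\<lparr>carrier := A\<rparr>)" using fin(2) L by simp
  qed (use inv in \<open>simp add: genL\<close>)
  then obtain as d h where *: "cyclic_direct_product (G\<lparr>carrier := A\<rparr>) A (as @ [d])"
    "\<forall>a\<in>set as. A.ord a = 0 \<or> odd (A.ord a)" "A.ord d = 2 ^ h"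
    unfolding genL by blast
  note D = *(1)[unfolded cyclic_direct_product_def, THEN conjunct1]
    *(1)[unfolded cyclic_direct_product_def, THEN conjunct2, THEN conjunct1]
    *(1)[unfolded cyclic_direct_product_def, THEN conjunct2, THEN conjunct2, THEN conjunct1]
    *(1)[unfolded cyclic_direct_product_def, THEN conjunct2, THEN conjunct2, THEN conjunct2]
  have sub: "set (as @ [d]) \<subseteq> A" using D(1) by simp
  have gen1: "generate (G\<lparr>carrier := A\<rparr>) {(as @ [d]) ! i} = generate G {(as @ [d]) ! i}"
    if "i < length (as @ [d])" for i
    using sub nth_mem[OF that] by (intro gen) blast
  have "cyclic_direct_product G A (as @ [d])"
    unfolding cyclic_direct_product_def
  proof (intro conjI)
    show "set (as @ [d]) \<subseteq> carrier G" by (rule subset_trans[OF sub subgroup.subset[OF A(1)]])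
    have "A = generate (G\<lparr>carrier := A\<rparr>) (set (as @ [d]))" by (fact D(2))
    also have "\<dots> = generate G (set (as @ [d]))" by (fact gen[OF sub])
    finally show "A = generate G (set (as @ [d]))" .
    show "\<forall>u\<in>set (as @ [d]). \<forall>v\<in>set (as @ [d]). u \<otimes> v = v \<otimes> u"
    proof -
      have eq: "(\<otimes>\<^bsub>G\<lparr>carrier := A\<rparr>\<^esub>) = (\<otimes>)" by simp
      show ?thesis using D(3) unfolding eq .
    qed
    show "\<forall>ys. length ys = length (as @ [d]) \<longrightarrow> (\<forall>i<length (as @ [d]). ys ! i \<in> generate G {(as @ [d]) ! i}) \<longrightarrow>
        foldr (\<otimes>) ys \<one> = \<one> \<longrightarrow> (\<forall>i<length ys. ys ! i = \<one>)"
    proof (intro allI impI)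
      fix ys i
      assume ys: "length ys = length (as @ [d])" "\<forall>i<length (as @ [d]). ys ! i \<in> generate G {(as @ [d]) ! i}"
        "foldr (\<otimes>) ys \<one> = \<one>" "i < length ys"
      have "\<forall>i<length (as @ [d]). ys ! i \<in> generate (G\<lparr>carrier := A\<rparr>) {(as @ [d]) ! i}"
        using ys(2) gen1 by blast
      moreover have "foldr (\<otimes>\<^bsub>G\<lparr>carrier := A\<rparr>\<^esub>) ys \<one>\<^bsub>G\<lparr>carrier := A\<rparr>\<^esub> = \<one>\<^bsub>G\<lparr>carrier := A\<rparr>\<^esub>"
        using ys(3) by simp
      ultimately have "ys ! i = \<one>\<^bsub>G\<lparr>carrier := A\<rparr>\<^esub>"
        using D(4)[THEN spec, THEN mp, THEN mp, THEN mp, THEN spec, THEN mp, OF ys(1)] ys(4) by blast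
      then show "ys ! i = \<one>" by simp
    qed
  qed
  moreover have "A.ord a = ord a" if "a \<in> set (as @ [d])" for a using ord_subgroup[OF A(1)] sub that by blast
  ultimately have "cyclic_direct_product G A (as @ [d]) \<and> (\<forall>a\<in>set as. ord a = 0 \<or> odd (ord a)) \<and> ord d = 2 ^ h"
    using *(2,3) by simp
  then show ?thesis by blast
qed

section \<open>Groups with an inverted abelian subgroup\<close>

context group
begin

text \<open>As \<open>2^n\<close> divides \<open>2 k\<close> but not \<open>k\<close>, the exponent
  \<open>k\<close> is an odd multiple of \<open>2^(n-1)\<close>, hence congruent to
  \<open>2^(n-1)\<close> modulo \<open>2^n\<close>. When the lemma is used for \<open>d\<close>, the
  conclusion \<open>n > 0\<close> supplies the guard \<open>h > 0\<close>.\<close>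

lemma involution_in_cyclic_2_group:
  fixes k :: int
  assumes x: "x \<in> carrier G" "ord x = 2 ^ n" and k: "x [^] k \<noteq> \<one>" "x [^] k \<otimes> x [^] k = \<one>"
  shows "n > 0" "x [^] k = x [^] (2 ^ (n - 1) :: nat)"
proof -
  have "x [^] (2 * k) = \<one>" using k(2) x(1) int_pow_mult[of x k k] by simp
  then have dvd: "2 ^ n dvd 2 * k" using int_pow_eq_id[OF x(1)] x(2) by simp
  have ndvd: "\<not> 2 ^ n dvd k" using k(1) int_pow_eq_id[OF x(1)] x(2) by simp
  show n: "n > 0" using ndvd by (cases n) auto
  then obtain m where m: "n = Suc m" by (cases n) auto
  then obtain s where s: "k = 2 ^ m * s" using dvd by auto
  have "odd s"
  proof
    assume "even s"
    then obtain s' where "s = 2 * s'" by blast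
    then have "k = 2 ^ n * s'" using s m by simp
    then show False using ndvd by simp
  qed
  then obtain s' where "s = 2 * s' + 1" by (elim oddE)
  then have "k - 2 ^ m = 2 ^ n * s'" using s m by (simp add: algebra_simps)
  then have "2 ^ n dvd k - 2 ^ m" by simp
  then have "x [^] k = x [^] (2 ^ m :: int)"
    using int_pow_eq[OF x(1), of k "2 ^ m"] x(2) by (simp add: dvd_diff_commute)
  then show "x [^] k = x [^] (2 ^ (n - 1) :: nat)"
    using m int_pow_int[of G x "2 ^ m"] by simp
qed

lemma generate_list_foldr:
  assumes "set gs \<subseteq> carrier G" "\<And>u v. u \<in> set gs \<Longrightarrow> v \<in> set gs \<Longrightarrow> u \<otimes> v = v \<otimes> u"
    and "c \<in> generate G (set gs)"
  shows "\<exists>ys. list_all2 (\<lambda>y g. y \<in> generate G {g}) ys gs \<and> c = foldr (\<otimes>) ys \<one>"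
  using assms
proof (induction gs arbitrary: c)
  case Nil
  then show ?case using generate_empty by auto
next
  case (Cons x gs)
  have gs: "set gs \<subseteq> carrier G" and x: "x \<in> carrier G" using Cons.prems(1) by auto
  note T = generate_is_subgroup[OF gs]
  note TG = subgroup.mem_carrier[OF T]
  have comm: "x \<otimes> t = t \<otimes> x" if "t \<in> generate G (set gs)" for t
    using comm_generate[OF gs x _ that] Cons.prems(2) by simp
  have c1: "conj G t x = t" if "t \<in> generate G (set gs)" for t
    using conj_eq_self_iff[OF TG[OF that] x] comm[OF that] by simp
  have c2: "conj G t (inv x) = t" if "t \<in> generate G (set gs)" for t
    using conj_conj_inv(1)[OF TG[OF that] x] c1[OF that] by simp
  have "insert x (set gs) \<subseteq> insert x (generate G (set gs))" by (auto intro: generate.incl)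
  from subsetD[OF mono_generate[OF this], of c]
  have "c \<in> generate G (insert x (generate G (set gs)))" using Cons.prems(3) by simp
  from generate_insert_normalizing[OF T x _ _ this]
  obtain t l where t: "t \<in> generate G (set gs)" "c = t \<otimes> x [^] (l::int)"
    unfolding c1 c2 using c1 c2 by metis
  have ct: "c = x [^] l \<otimes> t" using t comm_int_pow_left[OF x TG[OF t(1)] comm[OF t(1)]] by simp
  obtain ys where ys: "list_all2 (\<lambda>y g. y \<in> generate G {g}) ys gs" "t = foldr (\<otimes>) ys \<one>"
    using Cons.IH[OF gs _ t(1)] Cons.prems(2) by auto
  have "x [^] l \<in> generate G {x}" using x by (auto simp: generate_pow)
  then show ?case using ys ct by (intro exI[of _ "x [^] l # ys"]) simp
qed

lemma foldr_mult_square: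
  assumes "set ys \<subseteq> carrier G" "\<And>u v. u \<in> set ys \<Longrightarrow> v \<in> set ys \<Longrightarrow> u \<otimes> v = v \<otimes> u"
  shows "foldr (\<otimes>) ys \<one> \<otimes> foldr (\<otimes>) ys \<one> = foldr (\<otimes>) (map (\<lambda>y. y \<otimes> y) ys) \<one>"
  using assms
proof (induction ys)
  case (Cons y ys)
  have yG: "y \<in> carrier G" "set ys \<subseteq> carrier G" using Cons.prems(1) by auto
  have *: "foldr (\<otimes>) zs \<one> \<otimes> y = y \<otimes> foldr (\<otimes>) zs \<one>" if "set zs \<subseteq> set ys" for zs
    using that
  proof (induction zs)
    case (Cons z zs)
    then have "z \<in> carrier G" "set zs \<subseteq> carrier G" using yG by auto
    then show ?case using Cons yG Cons.prems Cons.IH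
      by simp (intro comm_mult_left foldr_mult_closed, use \<open>\<And>u v. u \<in> set (y # ys) \<Longrightarrow> v \<in> set (y # ys) \<Longrightarrow> u \<otimes> v = v \<otimes> u\<close> in auto)
  qed (use yG in simp)
  let ?f = "foldr (\<otimes>) ys \<one>"
  have f: "?f \<in> carrier G" using foldr_mult_closed yG by simp
  have "(y \<otimes> ?f) \<otimes> (y \<otimes> ?f) = (y \<otimes> y) \<otimes> (?f \<otimes> ?f)"
    using *[of ys] yG f by (intro mult_swap_middle) auto
  then show ?case using Cons by simp
qed simp

text \<open>Squaring \<open>c\<close> squares each of its components, and by independence all these
  squares are trivial. A cyclic group of infinite or odd order has no involution, so only the
  component in \<open><d>\<close> survives.\<close>

lemma involution_in_last_factor:
  assumes cdp: "cyclic_direct_product G A (as @ [d])"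
    and odd: "\<And>a. a \<in> set as \<Longrightarrow> ord a = 0 \<or> odd (ord a)"
    and c: "c \<in> A" "c \<otimes> c = \<one>"
  shows "c \<in> generate G {d}"
proof -
  let ?gs = "as @ [d]"
  have carr: "set ?gs \<subseteq> carrier G" and A: "A = generate G (set ?gs)"
    and comm: "\<And>u v. u \<in> set ?gs \<Longrightarrow> v \<in> set ?gs \<Longrightarrow> u \<otimes> v = v \<otimes> u"
    and ind: "\<And>ys. list_all2 (\<lambda>y g. y \<in> generate G {g}) ys ?gs \<Longrightarrow> foldr (\<otimes>) ys \<one> = \<one> \<Longrightarrow> set ys \<subseteq> {\<one>}"
  proof -
    note D = cdp[unfolded cyclic_direct_product_iff]
    show "set ?gs \<subseteq> carrier G" by (fact D[THEN conjunct1])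
    show "A = generate G (set ?gs)" by (fact D[THEN conjunct2, THEN conjunct1])
    show "u \<otimes> v = v \<otimes> u" if "u \<in> set ?gs" "v \<in> set ?gs" for u v
      using D[THEN conjunct2, THEN conjunct2, THEN conjunct1] that by blast
    show "set ys \<subseteq> {\<one>}"
      if "list_all2 (\<lambda>y g. y \<in> generate G {g}) ys ?gs" "foldr (\<otimes>) ys \<one> = \<one>" for ys
      using D[THEN conjunct2, THEN conjunct2, THEN conjunct2] that by blast
  qed
  have "\<exists>ys. list_all2 (\<lambda>y g. y \<in> generate G {g}) ys ?gs \<and> c = foldr (\<otimes>) ys \<one>"
    by (rule generate_list_foldr[OF carr _ c(1)[unfolded A]]) (rule comm)
  then obtain ys where
    ys': "list_all2 (\<lambda>y g. y \<in> generate G {g}) ys ?gs \<and> c = foldr (\<otimes>) ys \<one>" ..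
  note ys = conjunct1[OF ys'] conjunct2[OF ys']
  have pow: "\<exists>g\<in>set ?gs. \<exists>k::int. y = g [^] k" if y: "y \<in> set ys" for y
  proof -
    obtain g where g: "g \<in> set ?gs" "y \<in> generate G {g}"
      using list_all2_ex_right[OF ys(1) y] by blast
    then have "g \<in> carrier G" using carr by blast
    from g(2)[unfolded generate_pow[OF this]] g(1) show ?thesis by blast
  qed
  have ysG: "set ys \<subseteq> carrier G"
  proof
    fix y assume "y \<in> set ys"
    then obtain g k where "g \<in> set ?gs" "y = g [^] (k::int)" using pow by blast
    then show "y \<in> carrier G" using carr int_pow_closed by blast
  qed
  have yscomm: "u \<otimes> v = v \<otimes> u" if uv: "u \<in> set ys" "v \<in> set ys" for u v
  proof -
    obtain g k g' k' where g: "g \<in> set ?gs" "u = g [^] (k::int)" "g' \<in> set ?gs" "v = g' [^] (k'::int)"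
      using pow[OF uv(1)] pow[OF uv(2)] by blast
    then show ?thesis using comm_int_pow[of g g' k k'] comm[OF g(1,3)] carr by blast
  qed
  have "foldr (\<otimes>) ys \<one> \<otimes> foldr (\<otimes>) ys \<one> = foldr (\<otimes>) (map (\<lambda>y. y \<otimes> y) ys) \<one>"
    by (rule foldr_mult_square[OF ysG]) (rule yscomm)
  then have "foldr (\<otimes>) (map (\<lambda>y. y \<otimes> y) ys) \<one> = \<one>"
    using c(2) unfolding ys(2) by simp
  moreover have "list_all2 (\<lambda>y g. y \<in> generate G {g}) (map (\<lambda>y. y \<otimes> y) ys) ?gs"
    unfolding list_all2_map1 using ys(1) by (rule list_all2_mono) (auto intro: generate.eng)
  ultimately have sq: "y \<otimes> y = \<one>" if "y \<in> set ys" for y using ind that by fastforce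
  obtain zs v where zs: "ys = zs @ [v]" "list_all2 (\<lambda>y g. y \<in> generate G {g}) zs as" "v \<in> generate G {d}"
    using ys(1) by (auto simp: list_all2_append2 list_all2_Cons2)
  have "z = \<one>" if z: "z \<in> set zs" for z
  proof -
    obtain a where a: "a \<in> set as" "z \<in> generate G {a}"
      using list_all2_ex_right[OF zs(2) z] by blast
    have aG: "a \<in> carrier G" using a carr by auto
    obtain k :: int where k: "z = a [^] k" using a generate_pow[OF aG] by blast
    have "a [^] (k + k) = \<one>" using sq[of z] z zs(1) unfolding k int_pow_mult[OF aG] by simp
    \<comment> \<open>For \<open>ord a = 0\<close> this means \<open>k = 0\<close>; for odd
      \<open>ord a\<close> the factor 2 cancels.\<close>
    then have "int (ord a) dvd 2 * k" using int_pow_eq_id[OF aG, of "k + k"] by simp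
    moreover have "coprime (int (ord a)) 2" if "odd (ord a)" using that by simp
    ultimately have "int (ord a) dvd k" using odd[OF a(1)] by (auto simp: coprime_dvd_mult_right_iff)
    then show ?thesis using k int_pow_eq_id[OF aG] by simp
  qed
  then have "set zs \<subseteq> {\<one>}" by blast
  then have "foldr (\<otimes>) zs u = u" if "u \<in> carrier G" for u
    using that by (induction zs) auto
  moreover have "v \<in> carrier G" using ysG zs(1) by simp
  ultimately have "c = v" using ys(2) zs(1) by simp
  then show ?thesis using zs(3) by simp
qed

section \<open>Sufficiency of the structure\<close>

text \<open>The square \<open>q\<close> of \<open>x\<close> is central. A non-abelian
  \<open>H\<close> contains some \<open>y\<close> with odd exponent of \<open>x\<close>, and
  \<open>y^2\<close> generates \<open><q>\<close>, so \<open>q\<close> is in \<open>H\<close>. An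
  element centralizing \<open>H\<close> is an element of \<open>A\<close> with trivial square times
  a power of \<open>q\<close>, and that element of \<open>A\<close> is a power of \<open>q\<close>
  as well.\<close>

lemma self_centralizing_if_inverting:
  assumes x: "x \<in> carrier G" "ord x = 2 ^ n" and A: "subgroup A G"
    and Acomm: "\<And>a b. a \<in> A \<Longrightarrow> b \<in> A \<Longrightarrow> a \<otimes> b = b \<otimes> a"
    and gen: "carrier G = A <#> generate G {x}"
    and inverting: "\<And>a. a \<in> A \<Longrightarrow> conj G a x = inv a"
    and invol: "\<And>c. c \<in> A \<Longrightarrow> c \<otimes> c = \<one> \<Longrightarrow> c \<noteq> \<one> \<Longrightarrow> c = x [^] (2 ^ (n - 1) :: nat)"
    and H: "subgroup H G" "\<not> comm_group (G\<lparr>carrier := H\<rparr>)"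
  shows "centralizer G H \<subseteq> H"
proof
  note AG = subgroup.mem_carrier[OF A] and HG = subgroup.mem_carrier[OF H(1)]
  define q where "q = x \<otimes> x"
  have qG: "q \<in> carrier G" using x by (simp add: q_def)
  have q_pow: "x [^] (2 * j) = q [^] j" for j :: int
    using x(1) int_pow_mult[of x 1 1] by (simp add: q_def flip: int_pow_pow)
  have rep: "\<exists>a\<in>A. \<exists>k::int. g = a \<otimes> x [^] k" if "g \<in> carrier G" for g
    using that unfolding gen set_mult_def generate_pow[OF x(1)] by blast
  have qA: "q \<otimes> a = a \<otimes> q" if "a \<in> A" for a
  proof -
    have "conj G a q = a"
      using that AG x inverting by (simp add: q_def conj_inv flip: conj_conj)
    then show ?thesis using conj_eq_self_iff[OF AG[OF that] qG] by simp
  qed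
  have qx: "q \<otimes> x = x \<otimes> q" using x by (simp add: q_def m_assoc)
  have q_central: "q [^] j \<otimes> g = g \<otimes> q [^] j" if g: "g \<in> carrier G" for g and j :: int
  proof -
    obtain a k where a: "a \<in> A" "g = a \<otimes> x [^] (k::int)" using rep[OF g] by blast
    have "g \<otimes> q = q \<otimes> g"
      unfolding a(2) using AG[OF a(1)] x(1) qG qA[OF a(1)] comm_int_pow_left[OF x(1) qG qx [symmetric]]
      by (intro comm_mult_left) auto
    then show ?thesis using comm_int_pow_left[OF qG g] by simp
  qed
  have conj_q: "conj G g (q [^] j) = g" if "g \<in> carrier G" for g and j :: int
    using conj_eq_self_iff[OF that] q_central[OF that] qG by simp
  \<comment> \<open>Elements with even and with odd exponent of \<open>x\<close>: the former commute
    with each other, the latter invert \<open>A\<close>, and together they cover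
    \<open>G\<close>.\<close>
  define Ev where "Ev = {a \<otimes> q [^] j | a (j::int). a \<in> A}"
  define Od where "Od = {a \<otimes> q [^] j \<otimes> x | a (j::int). a \<in> A}"
  have EvG: "Ev \<subseteq> carrier G" using AG qG by (auto simp: Ev_def)
  have OdG: "Od \<subseteq> carrier G" using AG qG x by (auto simp: Od_def)
  have cases: "g \<in> Ev \<or> g \<in> Od" if g: "g \<in> carrier G" for g
  proof -
    obtain a k where a: "a \<in> A" "g = a \<otimes> x [^] (k::int)" using rep[OF g] by blast
    show ?thesis
    proof (cases "even k")
      case True
      then obtain j where "k = 2 * j" by blast
      then show ?thesis using a q_pow by (auto simp: Ev_def)
    next
      case False
      then obtain j where "k = 2 * j + 1" by (elim oddE)
      then have "x [^] k = q [^] j \<otimes> x" using x(1) by (simp add: int_pow_mult q_pow)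
      then have "g = a \<otimes> q [^] j \<otimes> x" using a AG qG x by (simp add: m_assoc)
      then show ?thesis using a(1) by (auto simp: Od_def)
    qed
  qed
  have conj_Od: "conj G a y = inv a" if aA: "a \<in> A" and yOd: "y \<in> Od" for a y
  proof -
    obtain b j where b: "b \<in> A" "y = b \<otimes> q [^] (j::int) \<otimes> x" using yOd by (auto simp: Od_def)
    have "conj G a b = a" using conj_eq_self_iff AG Acomm aA b(1) by simp
    then have "conj G a y = conj G a x"
      unfolding b(2) using AG[OF aA] AG[OF b(1)] qG x(1) conj_q by (simp flip: conj_conj)
    then show ?thesis using inverting[OF aA] by simp
  qed
  have conj_Ev_Od: "conj G (a \<otimes> q [^] j) y = inv a \<otimes> q [^] j" if "a \<in> A" "y \<in> Od" for a y and j :: int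
  proof -
    have yG: "y \<in> carrier G" using that(2) OdG by blast
    have "conj G (q [^] j) y = q [^] j"
      using conj_eq_self_iff[of "q [^] j" y] q_central[OF yG] qG yG by simp
    then show ?thesis using conj_Od[OF that] AG[OF that(1)] qG yG by (simp add: conj_mult)
  qed
  have Ev_comm: "u \<otimes> v = v \<otimes> u" if uv: "u \<in> Ev" "v \<in> Ev" for u v
  proof -
    obtain a j b k where a: "a \<in> A" "u = a \<otimes> q [^] (j::int)" "b \<in> A" "v = b \<otimes> q [^] (k::int)"
      using uv by (auto simp: Ev_def)
    have vG: "v \<in> carrier G" using uv EvG by blast
    have "b \<otimes> q [^] k \<otimes> a = a \<otimes> (b \<otimes> q [^] k)"
      using AG[OF a(1)] AG[OF a(3)] qG Acomm[OF a(3,1)] q_central[OF AG[OF a(1)]] by (intro comm_mult_left) auto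
    then have "a \<otimes> v = v \<otimes> a" using a(4) by simp
    then show ?thesis
      unfolding a(2) using AG[OF a(1)] vG qG q_central[OF vG] by (intro comm_mult_left) auto
  qed
  have Ev_quot: "u \<otimes> inv y \<in> Ev" if uy: "u \<in> Od" "y \<in> Od" for u y
  proof -
    obtain a j b k where a: "a \<in> A" "u = a \<otimes> q [^] (j::int) \<otimes> x" "b \<in> A" "y = b \<otimes> q [^] (k::int) \<otimes> x"
      using uy by (auto simp: Od_def)
    note G = AG[OF a(1)] AG[OF a(3)] qG x(1)
    have "inv y = inv x \<otimes> (q [^] (- k) \<otimes> inv b)" using G by (simp add: a(4) inv_mult_group int_pow_neg)
    also have "\<dots> = inv x \<otimes> (inv b \<otimes> q [^] (- k))" using q_central[of "inv b" "- k"] G by simp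
    finally have "u \<otimes> inv y = (a \<otimes> q [^] j) \<otimes> (inv b \<otimes> q [^] (- k))"
      using G by (simp add: a(2) m_assoc) (simp add: m_assoc [symmetric])
    also have "\<dots> = (a \<otimes> inv b) \<otimes> (q [^] j \<otimes> q [^] (- k))"
      using G q_central[of "inv b" j] by (intro mult_swap_middle) auto
    also have "\<dots> = (a \<otimes> inv b) \<otimes> q [^] (j - k)" using G by (simp add: int_pow_mult [symmetric])
    finally show ?thesis
      using subgroup.m_closed[OF A a(1) subgroup.m_inv_closed[OF A a(3)]] by (auto simp: Ev_def)
  qed
  obtain y where y: "y \<in> H" "y \<in> Od"
  proof (rule ccontr)
    assume "\<not> thesis"
    then have "H \<subseteq> Ev" using cases HG that by blast
    then show False using H comm_group_subgroup_iff[OF H(1)] Ev_comm by blast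
  qed
  have yG: "y \<in> carrier G" using y HG by blast
  \<comment> \<open>If \<open>y\<close> commuted with all of \<open>H \<inter> Ev\<close>, then
    \<open>H\<close> would be abelian, being covered by \<open>H \<inter> Ev\<close> and its
    translate by \<open>y\<close>.\<close>
  obtain b where b: "b \<in> H" "b \<in> Ev" "b \<otimes> y \<noteq> y \<otimes> b"
  proof (rule ccontr)
    assume "\<not> thesis"
    then have comm: "b \<otimes> y = y \<otimes> b" if "b \<in> H" "b \<in> Ev" for b using that \<open>\<And>b. \<lbrakk>b \<in> H; b \<in> Ev; b \<otimes> y \<noteq> y \<otimes> b\<rbrakk> \<Longrightarrow> thesis\<close> by blast
    have dec: "\<exists>e\<in>H \<inter> Ev. u = e \<or> u = e \<otimes> y" if u: "u \<in> H" for u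
    proof (cases "u \<in> Ev")
      case True
      then show ?thesis using u by blast
    next
      case False
      then have "u \<in> Od" using cases HG[OF u] by blast
      then have "u \<otimes> inv y \<in> H \<inter> Ev"
        using Ev_quot[OF _ y(2)] subgroup.m_closed[OF H(1) u subgroup.m_inv_closed[OF H(1) y(1)]] by blast
      moreover have "u = u \<otimes> inv y \<otimes> y" using HG[OF u] yG by (simp add: m_assoc)
      ultimately show ?thesis by blast
    qed
    have 1: "e \<otimes> v = v \<otimes> e" if e: "e \<in> H \<inter> Ev" and v: "v \<in> H" for e v
    proof -
      obtain f where f: "f \<in> H \<inter> Ev" "v = f \<or> v = f \<otimes> y" using dec[OF v] by blast
      have G: "e \<in> carrier G" "f \<in> carrier G" using e f EvG by auto
      have "f \<otimes> e = e \<otimes> f" using Ev_comm e f by blast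
      moreover have "y \<otimes> e = e \<otimes> y" using comm e by simp
      ultimately show ?thesis using f(2) comm_mult_left[OF G(2) yG G(1)] by auto
    qed
    have "u \<otimes> v = v \<otimes> u" if u: "u \<in> H" and v: "v \<in> H" for u v
    proof -
      obtain e where e: "e \<in> H \<inter> Ev" "u = e \<or> u = e \<otimes> y" using dec[OF u] by blast
      obtain f where f: "f \<in> H \<inter> Ev" "v = f \<or> v = f \<otimes> y" using dec[OF v] by blast
      have G: "e \<in> carrier G" "f \<in> carrier G" using e f EvG by auto
      have "f \<otimes> y = y \<otimes> f" using comm f by simp
      then have "v \<otimes> y = y \<otimes> v" using f(2) comm_mult_left[OF G(2) yG yG] by auto
      then show ?thesis using 1[OF e(1) v] e(2) comm_mult_left[OF G(1) yG HG[OF v]] by auto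
    qed
    then show False using H comm_group_subgroup_iff[OF H(1)] by blast
  qed
  obtain a j where a: "a \<in> A" "b = a \<otimes> q [^] (j::int)" using b(2) by (auto simp: Ev_def)
  have bG: "b \<in> carrier G" using b HG by blast
  have a_inv: "inv a \<noteq> a"
  proof
    assume "inv a = a"
    then have "conj G b y = b" using conj_Ev_Od[OF a(1) y(2)] a(2) by simp
    then show False using b(3) conj_eq_self_iff[OF bG yG] by simp
  qed
  \<comment> \<open>The \<open>A\<close>-part \<open>c\<close> of \<open>y\<close> cancels in
    \<open>y^2\<close>, which is therefore \<open>q^(2k+1)\<close>. An odd exponent is invertible
    modulo \<open>2^n\<close>, so \<open>q\<close> is a power of \<open>y^2\<close>.\<close>
  have qH: "q [^] i \<in> H" for i :: int
  proof -
    obtain c k where c: "c \<in> A" "y = c \<otimes> q [^] (k::int) \<otimes> x" using y(2) by (auto simp: Od_def)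
    note G = AG[OF c(1)] qG x(1)
    have xqk: "q [^] k \<otimes> x = x \<otimes> q [^] k" using q_central[OF x(1)] .
    have "y = c \<otimes> (q [^] k \<otimes> x)" using c(2) G by (simp add: m_assoc)
    then have "y \<otimes> y = (y \<otimes> c) \<otimes> (q [^] k \<otimes> x)" using G yG by (simp add: m_assoc)
    also have "y \<otimes> c = inv c \<otimes> y"
      using mult_eq_mult_conj(1)[of "inv c" y] conj_inv[OF G(1) yG] conj_Od[OF c(1) y(2)] G yG by simp
    also have "inv c \<otimes> y = q [^] k \<otimes> x" using c(2) G by (simp add: m_assoc [symmetric])
    also have "(q [^] k \<otimes> x) \<otimes> (q [^] k \<otimes> x) = (q [^] k \<otimes> q [^] k) \<otimes> (x \<otimes> x)"
      using G xqk by (intro mult_swap_middle) auto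
    also have "\<dots> = q [^] (2 * k + 1)"
      unfolding q_def [symmetric] mult_2 int_pow_mult[OF qG] int_pow_1[OF qG] ..
    finally have yy: "q [^] (2 * k + 1) \<in> H" using subgroup.m_closed[OF H(1) y(1) y(1)] by simp
    have "coprime (2 * k + 1) (2 ^ n)" by simp
    then obtain u v where "u * (2 * k + 1) + v * 2 ^ n = 1" using bezout_int[of "2 * k + 1" "2 ^ n"] by auto
    then have uv: "(2 * k + 1) * u = 1 + 2 ^ n * (- v)" by (simp add: algebra_simps)
    have "(q [^] (2 * k + 1)) [^] u = q [^] (1 + 2 ^ n * (- v))" unfolding int_pow_pow[OF qG] uv ..
    also have "\<dots> = q \<otimes> q [^] (2 ^ n * (- v))" using qG by (simp only: int_pow_mult int_pow_1)
    also have "q [^] (2 ^ n * (- v)) = x [^] (2 * (2 ^ n * (- v)))" by (simp only: q_pow)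
    also have "\<dots> = \<one>" using int_pow_eq_id[OF x(1), of "2 * (2 ^ n * (- v))"] x(2) by simp
    finally have "q = (q [^] (2 * k + 1)) [^] u" using qG by simp
    then have "q \<in> H" using subgroup_int_pow_closed[OF H(1) yy, of u] by simp
    then show ?thesis using subgroup_int_pow_closed[OF H(1)] by blast
  qed
  fix g assume g: "g \<in> centralizer G H"
  have gG: "g \<in> carrier G" using g by (simp add: centralizer_def)
  have gc: "g \<otimes> u = u \<otimes> g" if "u \<in> H" for u using g that by (simp add: centralizer_def)
  \<comment> \<open>An element of \<open>Od\<close> inverts the \<open>A\<close>-part
    \<open>a\<close> of \<open>b\<close>, but \<open>a\<close> differs from its inverse because
    \<open>b\<close> and \<open>y\<close> do not commute.\<close>
  have "g \<notin> Od"
  proof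
    assume "g \<in> Od"
    then have "conj G b g = inv a \<otimes> q [^] j" using conj_Ev_Od[OF a(1)] a(2) by simp
    moreover have "conj G b g = b" using conj_eq_self_iff[OF bG gG] gc[OF b(1)] by simp
    ultimately have "inv a \<otimes> q [^] j = a \<otimes> q [^] j" using a(2) by simp
    then show False using a_inv AG[OF a(1)] qG by simp
  qed
  then obtain c m where c: "c \<in> A" "g = c \<otimes> q [^] (m::int)" using cases[OF gG] by (auto simp: Ev_def)
  note cG = AG[OF c(1)]
  have "conj G g y = g" using conj_eq_self_iff[OF gG yG] gc[OF y(1)] by simp
  then have "inv c \<otimes> q [^] m = c \<otimes> q [^] m" using conj_Ev_Od[OF c(1) y(2)] c(2) by simp
  then have "inv c = c" using cG qG by simp
  then have cc: "c \<otimes> c = \<one>" using l_inv[OF cG] by simp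
  have "c \<in> H"
  proof (cases "c = \<one>")
    case True
    then show ?thesis using subgroup.one_closed[OF H(1)] by simp
  next
    case False
    then have cx: "c = x [^] (2 ^ (n - 1) :: nat)" using invol[OF c(1) cc] by blast
    show ?thesis
    proof (cases "n - 1")
      \<comment> \<open>By truncated subtraction this covers \<open>n = 0\<close> and
        \<open>n = 1\<close>. Then \<open>x = c\<close> would lie in \<open>A\<close> and both fix
        and invert \<open>a\<close>.\<close>
      case 0
      then have "c = x" using cx x(1) by simp
      then have "conj G a x = a" using conj_eq_self_iff[OF AG[OF a(1)] x(1)] Acomm[OF a(1) c(1)] by simp
      then show ?thesis using inverting[OF a(1)] a_inv by simp
    next
      case (Suc l)
      then have "c = x [^] (2 * 2 ^ l :: int)" using cx int_pow_int[of G x "2 * 2 ^ l"] by simp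
      then have "c = q [^] (2 ^ l :: int)" by (simp only: q_pow)
      then show ?thesis using qH by simp
    qed
  qed
  then show "g \<in> H" unfolding c(2) using subgroup.m_closed[OF H(1)] qH by blast
qed

end

section \<open>Groups with self-centralizing non-abelian subgroups\<close>

text \<open>All is read off from the action on an infinite cyclic normal \<open><z>\<close>:
  \<open>C\<close> fixes \<open>z\<close> and \<open>I\<close> inverts it. The statement only
  locates the involutions of \<open>A\<close>; its decomposition into cyclic factors comes
  later.\<close>

lemma (in group) inverting_structure_if_self_centralizing:
  assumes nab: "\<not> comm_group G" and inf: "infinite (carrier G)" and S: "supersoluble_series G N r"
    and P: "\<And>H. \<lbrakk>subgroup H G; \<not> comm_group (G\<lparr>carrier := H\<rparr>)\<rbrakk> \<Longrightarrow> centralizer G H \<subseteq> H"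
  shows "\<exists>A x n. x \<in> carrier G \<and> carrier G = A <#> generate G {x} \<and> ord x = 2 ^ n \<and> subgroup A G \<and>
    comm_group (G\<lparr>carrier := A\<rparr>) \<and> (\<forall>a\<in>A. conj G a x = inv a) \<and>
    (\<forall>e\<in>A. e \<noteq> \<one> \<longrightarrow> e \<otimes> e = \<one> \<longrightarrow> e = x [^] (2 ^ (n - 1) :: nat))"
proof -
  obtain z where z: "z \<in> carrier G" "ord z = 0" and zconj: "\<forall>g\<in>carrier G. \<exists>j::int. conj G z g = z [^] j"
    using infinite_cyclic_normal_subgroup[OF S inf] by blast
  have abel: "u \<otimes> v = v \<otimes> u"
    if "w \<in> carrier G" "ord w = 0" "u \<in> carrier G" "u \<otimes> w = w \<otimes> u" "v \<in> carrier G" "v \<otimes> w = w \<otimes> v" for u v w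
    by (rule centralizer_abelian_if_infinite_order[OF S _ that]) (rule P)
  have z0: "z [^] k = \<one> \<longleftrightarrow> k = 0" for k :: int using z by (simp add: int_pow_eq_id)
  have z_ne: "inv z \<noteq> z"
  proof
    assume "inv z = z"
    then have "z \<otimes> z = \<one>" using l_inv[OF z(1)] by simp
    then have "z [^] (2::int) = \<one>" using z(1) int_pow_mult[of z 1 1] by simp
    then show False using z0 by simp
  qed
  have dich: "conj G z g = z \<or> conj G z g = inv z" if g: "g \<in> carrier G" for g
  proof -
    obtain j j' :: int where j: "conj G z g = z [^] j" "conj G z (inv g) = z [^] j'"
      using zconj g inv_closed[OF g] by blast
    have "z [^] (1::int) = conj G (conj G z g) (inv g)" using z g by simp
    also have "\<dots> = z [^] (j' * j)" using z g by (simp add: j conj_int_pow int_pow_pow)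
    finally have "j' * j = 1" using int_pow_eq[OF z(1)] z(2) by simp
    then have "j = 1 \<or> j = - 1" by (metis zmult_eq_1_iff)
    then show ?thesis using j(1) z(1) by (auto simp: int_pow_neg)
  qed
  define C where "C = {g \<in> carrier G. conj G z g = z}"
  define I where "I = {g \<in> carrier G. conj G z g = inv z}"
  have CG: "g \<in> carrier G" if "g \<in> C" for g using that by (simp add: C_def)
  have IG: "g \<in> carrier G" if "g \<in> I" for g using that by (simp add: I_def)
  have CI: "g \<in> C \<or> g \<in> I" if "g \<in> carrier G" for g using dich[OF that] that by (auto simp: C_def I_def)
  have disj: "g \<notin> C" if "g \<in> I" for g using that z_ne by (auto simp: C_def I_def)
  have Cz: "g \<in> C \<longleftrightarrow> g \<in> carrier G \<and> g \<otimes> z = z \<otimes> g" for g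
    using conj_eq_self_iff[OF z(1)] by (auto simp: C_def)
  have Ccomm: "u \<otimes> v = v \<otimes> u" if "u \<in> C" "v \<in> C" for u v
    using abel[OF z, of u v] that Cz by blast
  have C_eq: "C = centralizer G {z}" by (auto simp: Cz centralizer_def)
  have Csub: "subgroup C G" unfolding C_eq using subgroup_centralizer[of "{z}"] z by simp
  have C1: "\<one> \<in> C" using subgroup.one_closed[OF Csub] .
  have II: "g \<otimes> h \<in> C" if "g \<in> I" "h \<in> I" for g h
    using that z by (auto simp: C_def I_def conj_inv simp flip: conj_conj)
  have IC: "g \<otimes> h \<in> I" if "g \<in> I" "h \<in> C" for g h
    using that z by (auto simp: C_def I_def conj_inv simp flip: conj_conj)
  have CIi: "h \<otimes> g \<in> I" if "g \<in> I" "h \<in> C" for g h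
    using that z by (auto simp: C_def I_def simp flip: conj_conj)
  have Iinv: "inv g \<in> I" if g: "g \<in> I" for g
  proof -
    have gG: "g \<in> carrier G" using IG[OF g] .
    have "conj G z g = inv z" using g by (simp add: I_def)
    then have "conj G (inv z) g = z" using z gG by (simp add: conj_inv)
    then have "conj G z (inv g) = inv z" using conj_conj_inv(1)[of "inv z" g] z gG by simp
    then show ?thesis using gG by (simp add: I_def)
  qed
  \<comment> \<open>\<open>G\<close> is covered by \<open>C\<close> and \<open>C g\<close>, and
    \<open>C\<close> is abelian, so commuting with a single \<open>g\<close> outside
    \<open>C\<close> suffices.\<close>
  have central: "u \<otimes> v = v \<otimes> u" if u: "u \<in> C" and g: "g \<in> I" and ug: "u \<otimes> g = g \<otimes> u" and v: "v \<in> carrier G" for u g v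
  proof (cases "v \<in> C")
    case True
    then show ?thesis using Ccomm u by blast
  next
    case False
    then have vI: "v \<in> I" using CI v by blast
    define t where "t = v \<otimes> inv g"
    have t: "t \<in> C" using II[OF vI Iinv[OF g]] by (simp add: t_def)
    have "v = t \<otimes> g" using v IG[OF g] by (simp add: t_def m_assoc)
    then have "v \<otimes> u = u \<otimes> v"
      using comm_mult_left[OF CG[OF t] IG[OF g] CG[OF u]] Ccomm[OF t u] ug by simp
    then show ?thesis by simp
  qed
  have sq_central: "(g \<otimes> g) \<otimes> v = v \<otimes> (g \<otimes> g)" if g: "g \<in> I" and v: "v \<in> carrier G" for g v
    using central[OF II[OF g g] g _ v] IG[OF g] by (simp add: m_assoc)
  \<comment> \<open>A central element of infinite order would make its centralizer, the whole of
    \<open>G\<close>, abelian.\<close>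
  have torsion: "ord w \<noteq> 0" if w: "w \<in> carrier G" and wc: "\<And>v. v \<in> carrier G \<Longrightarrow> w \<otimes> v = v \<otimes> w" for w
  proof
    assume "ord w = 0"
    then have "u \<otimes> v = v \<otimes> u" if "u \<in> carrier G" "v \<in> carrier G" for u v
      using abel[OF w] wc that by simp
    then show False using nab group_comm_groupI by blast
  qed
  have pow_odd: "g [^] (2 * l + 1) = (g \<otimes> g) [^] l \<otimes> g" "g [^] (2 * l) = (g \<otimes> g) [^] l"
    if g: "g \<in> carrier G" for g and l :: int
  proof -
    show e: "g [^] (2 * l) = (g \<otimes> g) [^] l" for l :: int
      using g int_pow_mult[of g 1 1] by (simp flip: int_pow_pow)
    show "g [^] (2 * l + 1) = (g \<otimes> g) [^] l \<otimes> g"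
      unfolding int_pow_mult[OF g] e int_pow_1[OF g] ..
  qed
  have odd_pow: "g [^] k \<in> I" if g: "g \<in> I" and k: "odd k" for g and k :: int
  proof -
    obtain l where "k = 2 * l + 1" using k by (elim oddE)
    then show ?thesis
      using pow_odd(1)[OF IG[OF g], of l] CIi[OF g subgroup_int_pow_closed[OF Csub II[OF g g]]] by simp
  qed
  \<comment> \<open>A central \<open>w\<close> lies in the non-abelian \<open><z, g>\<close>, so
    \<open>w = z^k g^l\<close>. As \<open>w\<close> is in \<open>C\<close>, the exponent
    \<open>l\<close> is even; then \<open>z^k\<close> commutes with \<open>g\<close>, which inverts
    \<open>z\<close>, so \<open>k = 0\<close>.\<close>
  have centre: "\<exists>l::int. w = (g \<otimes> g) [^] l"
    if g: "g \<in> I" and w: "w \<in> carrier G" and wc: "\<And>v. v \<in> carrier G \<Longrightarrow> w \<otimes> v = v \<otimes> w" for g w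
  proof -
    have gG: "g \<in> carrier G" using IG[OF g] .
    have zg: "conj G z g = inv z" "conj G z (inv g) = inv z" using g Iinv[OF g] by (simp_all add: I_def)
    have sub: "{z, g} \<subseteq> carrier G" using z gG by simp
    note gen = generate_is_subgroup[OF sub]
    have "z \<otimes> g \<noteq> g \<otimes> z" using conj_eq_self_iff[OF z(1) gG] zg z_ne by simp
    moreover have "z \<in> generate G {z, g}" "g \<in> generate G {z, g}" by (auto intro: generate.incl)
    ultimately have "\<not> comm_group (G\<lparr>carrier := generate G {z, g}\<rparr>)"
      using comm_group_subgroup_iff[OF gen] by blast
    moreover have "w \<in> centralizer G (generate G {z, g})"
      using w wc generate_in_carrier[OF sub] by (auto simp: centralizer_def)
    ultimately have "w \<in> generate G {z, g}" using P[OF gen] by blast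
    moreover have "{z, g} \<subseteq> insert g (generate G {z})" by (auto intro: generate.incl)
    ultimately have wgen: "w \<in> generate G (insert g (generate G {z}))" using mono_generate by blast
    have zsub: "subgroup (generate G {z}) G" using generate_is_subgroup[of "{z}"] z by simp
    have zcl: "conj G t h \<in> generate G {z}" if t: "t \<in> generate G {z}" and h: "h \<in> carrier G" "conj G z h = inv z" for t h
    proof -
      obtain k :: int where "t = z [^] k" using t unfolding generate_pow[OF z(1)] by blast
      then have "conj G t h = z [^] (- k)"
        using z h by (simp add: conj_int_pow int_pow_inv int_pow_neg)
      then show ?thesis unfolding generate_pow[OF z(1)] by blast
    qed
    have "\<exists>t\<in>generate G {z}. \<exists>l::int. w = t \<otimes> g [^] l"
      by (rule generate_insert_normalizing[OF zsub gG _ _ wgen]) (use zcl zg gG in auto)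
    then obtain k l :: int where wkl: "w = z [^] k \<otimes> g [^] l"
      unfolding generate_pow[OF z(1)] by blast
    have "even l"
    proof (rule ccontr)
      assume "odd l"
      then have gl: "g [^] l \<in> I" using odd_pow[OF g] by blast
      have "g [^] l = inv (z [^] k) \<otimes> w" using wkl z gG by (simp add: m_assoc [symmetric])
      moreover have "z \<in> C" using z by (simp add: Cz)
      then have "inv (z [^] k) \<in> C" using subgroup.m_inv_closed[OF Csub subgroup_int_pow_closed[OF Csub]] by blast
      moreover have "w \<in> C" using w wc z by (simp add: Cz)
      ultimately have "g [^] l \<in> C" using subgroup.m_closed[OF Csub] by simp
      then show False using disj[OF gl] by simp
    qed
    then obtain m where m: "l = 2 * m" by blast
    have gl: "g [^] l = (g \<otimes> g) [^] m" using pow_odd(2)[OF gG] m by simp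
    have "z [^] k = w \<otimes> inv (g [^] l)" using wkl z gG by (simp add: m_assoc)
    moreover have "inv (g [^] l) \<otimes> g = g \<otimes> inv (g [^] l)"
      using comm_inv_left[OF _ gG comm_int_pow_left[OF gG gG refl]] gG by simp
    ultimately have "z [^] k \<otimes> g = g \<otimes> z [^] k"
      using comm_mult_left[OF w _ gG wc[OF gG]] gG by simp
    then have "conj G (z [^] k) g = z [^] k" using conj_eq_self_iff[of "z [^] k" g] z gG by simp
    then have "z [^] (- k) = z [^] k" using z gG zg by (simp add: conj_int_pow int_pow_inv int_pow_neg)
    then have "k = 0" using int_pow_eq[OF z(1), of "- k" k] z(2) by simp
    then have "w = (g \<otimes> g) [^] m" using wkl gl gG by simp
    then show ?thesis by blast
  qed
  have "\<exists>x0. x0 \<in> I"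
  proof (rule ccontr)
    assume "\<not> ?thesis"
    then have "carrier G \<subseteq> C" using CI by blast
    then show False using nab group_comm_groupI Ccomm by blast
  qed
  then obtain x0 where x0: "x0 \<in> I" by blast
  have x0G: "x0 \<in> carrier G" using IG[OF x0] .
  have "ord (x0 \<otimes> x0) \<noteq> 0" using torsion[of "x0 \<otimes> x0"] sq_central[OF x0] x0G by blast
  moreover have "x0 [^] (2 * int (ord (x0 \<otimes> x0))) = \<one>"
    unfolding pow_odd(2)[OF x0G] using x0G by (simp add: int_pow_int)
  ultimately have ord0: "ord x0 \<noteq> 0" using ord_nonzero_if_int_pow_eq_one[OF x0G] by auto
  obtain m where "ord x0 = 2 ^ multiplicity 2 (ord x0) * m" "odd m"
    by (rule multiplicity_decompose'[of "ord x0" 2]) (use ord0 in auto)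
  then obtain n where nm: "ord x0 = 2 ^ n * m" "odd m" by blast
  \<comment> \<open>An odd power stays in \<open>I\<close>, and raising to the odd part of the order
    leaves a power of 2.\<close>
  define x where "x = x0 [^] m"
  have xI: "x \<in> I" using odd_pow[OF x0, of "int m"] nm(2) by (simp add: x_def int_pow_int)
  have xG: "x \<in> carrier G" using IG[OF xI] .
  have ordx: "ord x = 2 ^ n" using ord_pow[OF x0G, of m] nm ord0 by (simp add: x_def)
  define q where "q = x \<otimes> x"
  have qG: "q \<in> carrier G" and qC: "q \<in> C" using xG II[OF xI xI] by (simp_all add: q_def)
  have qc: "q [^] j \<otimes> v = v \<otimes> q [^] j" if v: "v \<in> carrier G" for v and j :: int
    using comm_int_pow_left[OF qG v] sq_central[OF xI v] by (simp add: q_def)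
  have qpow: "q [^] j = x [^] (2 * j)" for j :: int using pow_odd(2)[OF xG] by (simp add: q_def)
  define A where "A = {c \<in> C. conj G c x = inv c}"
  have AC: "c \<in> C" "conj G c x = inv c" if "c \<in> A" for c using that by (auto simp: A_def)
  have Asub: "subgroup A G"
  proof (rule subgroupI)
    show "A \<subseteq> carrier G" using AC CG by blast
    have "\<one> \<in> A" using C1 xG by (simp add: A_def conj_def)
    then show "A \<noteq> {}" by blast
  next
    fix a assume a: "a \<in> A"
    then show "inv a \<in> A"
      using AC[OF a] subgroup.m_inv_closed[OF Csub] CG xG by (simp add: A_def conj_inv)
  next
    fix a b assume a: "a \<in> A" and b: "b \<in> A"
    have "conj G (a \<otimes> b) x = inv a \<otimes> inv b" using AC[OF a] AC[OF b] CG xG by (simp add: conj_mult)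
    also have "\<dots> = inv (b \<otimes> a)" using AC[OF a] AC[OF b] CG by (simp add: inv_mult_group)
    also have "b \<otimes> a = a \<otimes> b" using Ccomm AC[OF a] AC[OF b] by blast
    finally show "a \<otimes> b \<in> A" using subgroup.m_closed[OF Csub] AC[OF a] AC[OF b] by (simp add: A_def)
  qed
  have Aab: "comm_group (G\<lparr>carrier := A\<rparr>)"
    using comm_group_subgroup_iff[OF Asub] Ccomm AC by blast
  have C_dec: "\<exists>a\<in>A. \<exists>j::int. c = a \<otimes> x [^] j" if c: "c \<in> C" for c
  proof -
    have cG: "c \<in> carrier G" using CG[OF c] .
    define c' where "c' = conj G c x"
    have c'G: "c' \<in> carrier G" using cG xG by (simp add: c'_def)
    have c'C: "c' \<in> C"
      unfolding c'_def conj_def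
      using II[OF CIi[OF Iinv[OF xI] _] xI] IC[OF Iinv[OF xI] c] II[OF _ xI] by blast
    have cc': "c' \<otimes> c = c \<otimes> c'" using Ccomm c c'C by blast
    have "conj G c' x = c"
      using sq_central[OF xI cG] conj_eq_self_iff[OF cG, of "x \<otimes> x"] cG xG by (simp add: c'_def conj_conj)
    \<comment> \<open>Conjugation by \<open>x\<close> exchanges \<open>c\<close> and
      \<open>c'\<close>, so their product is fixed by \<open>x\<close>, hence central and a power of
      \<open>q\<close>.\<close>
    then have "conj G (c \<otimes> c') x = c \<otimes> c'" using cG c'G xG cc' by (simp add: conj_mult flip: c'_def)
    then have "(c \<otimes> c') \<otimes> x = x \<otimes> (c \<otimes> c')" using conj_eq_self_iff[of "c \<otimes> c'" x] cG c'G xG by simp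
    then have "(c \<otimes> c') \<otimes> v = v \<otimes> (c \<otimes> c')" if "v \<in> carrier G" for v
      using central[OF subgroup.m_closed[OF Csub c c'C] xI _ that] by blast
    then obtain k :: int where k: "c \<otimes> c' = q [^] k"
      using centre[OF xI, of "c \<otimes> c'"] cG c'G by (auto simp: q_def)
    have "\<exists>j::int. c \<otimes> c' = q [^] (2 * j)"
    proof (cases "even k")
      case True
      then show ?thesis using k by blast
    next
      case False
      \<comment> \<open>The square of \<open>x c\<close> is \<open>q^(1+k)\<close>, and the central
        \<open>q\<close> must be a power of it. With \<open>1 + k\<close> even this is possible only
        for trivial \<open>q\<close>, and then the exponent 0 serves.\<close>
      define g where "g = x \<otimes> c"
      have gI: "g \<in> I" using IC[OF xI c] by (simp add: g_def)
      have "g \<otimes> g = x \<otimes> (c \<otimes> x) \<otimes> c" using xG cG by (simp add: g_def m_assoc)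
      also have "c \<otimes> x = x \<otimes> c'" using mult_eq_mult_conj(1)[OF cG xG] by (simp add: c'_def)
      also have "x \<otimes> (x \<otimes> c') \<otimes> c = q \<otimes> (c' \<otimes> c)" using xG cG c'G by (simp add: q_def m_assoc)
      also have "\<dots> = q [^] (1 + k)" unfolding cc' k int_pow_mult[OF qG] int_pow_1[OF qG] ..
      finally have gg: "g \<otimes> g = q [^] (1 + k)" .
      obtain l :: int where "q = (g \<otimes> g) [^] l"
        using centre[OF gI qG] qc[of _ 1] qG by auto
      then have "q [^] (1::int) = q [^] ((1 + k) * l)" using qG by (simp add: gg int_pow_pow)
      then have "x [^] (2::int) = x [^] (2 * ((1 + k) * l))" by (simp only: qpow mult_1_right)
      then have dvd: "2 ^ n dvd 2 * ((1 + k) * l) - 2"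
        using int_pow_eq[OF xG, of 2 "2 * ((1 + k) * l)"] ordx by simp
      have "\<not> (4::int) dvd 2 * ((1 + k) * l) - 2"
      proof
        assume "4 dvd 2 * ((1 + k) * l) - 2"
        then have "even ((1 + k) * l - 1)" by presburger
        then show False using False by simp
      qed
      moreover have "(4::int) dvd 2 ^ n" if "n \<ge> 2"
        using le_imp_power_dvd[OF that, of "2::int"] by simp
      ultimately have "n < 2" using dvd dvd_trans not_less by blast
      then have "2 ^ n dvd (2::int)" by (cases n) auto
      then have "q = \<one>" using int_pow_eq_id[OF xG, of 2] ordx qpow[of 1] qG by simp
      then have "c \<otimes> c' = q [^] (2 * 0 :: int)" using k by simp
      then show ?thesis by blast
    qed
    then obtain j :: int where j: "c \<otimes> c' = q [^] (2 * j)" by blast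
    \<comment> \<open>\<open>q^j\<close> is a central square root of \<open>c c'\<close>; dividing
      \<open>c\<close> by it makes \<open>a^x a\<close> trivial.\<close>
    define a where "a = c \<otimes> q [^] (- j)"
    have aG: "a \<in> carrier G" using cG qG by (simp add: a_def)
    have aC: "a \<in> C"
      unfolding a_def using subgroup.m_closed[OF Csub c subgroup_int_pow_closed[OF Csub qC]] by blast
    have qx: "conj G (q [^] (- j)) x = q [^] (- j)"
      using conj_eq_self_iff[of "q [^] (- j)" x] qc[OF xG] qG xG by simp
    have "conj G a x \<otimes> a = (c' \<otimes> q [^] (- j)) \<otimes> (c \<otimes> q [^] (- j))"
      using cG qG xG qx by (simp add: a_def conj_mult c'_def)
    also have "\<dots> = (c' \<otimes> c) \<otimes> (q [^] (- j) \<otimes> q [^] (- j))"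
      using c'G cG qG qc[OF cG] by (intro mult_swap_middle) auto
    also have "\<dots> = q [^] (2 * j + (- j + - j))" unfolding cc' j int_pow_mult[OF qG] ..
    also have "\<dots> = \<one>" by simp
    finally have "conj G a x = inv a" using inv_equality[OF _ aG] aG xG by simp
    then have "a \<in> A" using aC by (simp add: A_def)
    moreover have "c = a \<otimes> q [^] j"
      using cG qG by (simp add: a_def m_assoc int_pow_mult [symmetric])
    ultimately show ?thesis unfolding qpow by blast
  qed
  have dec: "\<exists>a\<in>A. \<exists>j::int. g = a \<otimes> x [^] j" if g: "g \<in> carrier G" for g
  proof (cases "g \<in> C")
    case False
    then have "g \<otimes> inv x \<in> C" using CI[OF g] II Iinv[OF xI] by blast
    then obtain a j where a: "a \<in> A" "g \<otimes> inv x = a \<otimes> x [^] (j::int)" using C_dec by blast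
    have aG: "a \<in> carrier G" using a AC CG by blast
    have "g = g \<otimes> inv x \<otimes> x" using g xG by (simp add: m_assoc)
    also have "\<dots> = a \<otimes> (x [^] j \<otimes> x)" unfolding a(2) using aG xG by (simp add: m_assoc)
    also have "x [^] j \<otimes> x = x [^] (j + 1)" using xG by (simp add: int_pow_mult)
    finally show ?thesis using a(1) by blast
  qed (use C_dec in blast)
  have "carrier G = A <#> generate G {x}"
  proof
    show "carrier G \<subseteq> A <#> generate G {x}"
    proof
      fix g assume "g \<in> carrier G"
      then obtain a j where a: "a \<in> A" "g = a \<otimes> x [^] (j::int)" using dec by blast
      have "x [^] j \<in> generate G {x}" unfolding generate_pow[OF xG] by blast
      then show "g \<in> A <#> generate G {x}" using a unfolding set_mult_def by blast
    qed
    show "A <#> generate G {x} \<subseteq> carrier G"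
      using set_mult_closed[OF subgroup.subset[OF Asub] generate_incl[of "{x}"]] xG by simp
  qed
  \<comment> \<open>An involution inverted by \<open>x\<close> is fixed by \<open>x\<close>, hence
    central and in \<open><x>\<close>, where there is only one involution.\<close>
  moreover have "e = x [^] (2 ^ (n - 1) :: nat)" if e: "e \<in> A" "e \<noteq> \<one>" "e \<otimes> e = \<one>" for e
  proof -
    have eG: "e \<in> carrier G" using AC[OF e(1)] CG by blast
    have "conj G e x = e" using AC(2)[OF e(1)] inv_equality[OF e(3) eG eG] by simp
    then have "e \<otimes> x = x \<otimes> e" using conj_eq_self_iff[OF eG xG] by simp
    then have "e \<otimes> v = v \<otimes> e" if "v \<in> carrier G" for v using central[OF AC(1)[OF e(1)] xI _ that] by blast
    then obtain l :: int where "e = (x \<otimes> x) [^] l" using centre[OF xI eG] by blast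
    then have "e = x [^] (2 * l)" using pow_odd(2)[OF xG] by simp
    then show ?thesis using involution_in_cyclic_2_group(2)[OF xG ordx, of "2 * l"] e by simp
  qed
  ultimately show ?thesis
    using xG ordx Asub Aab AC(2) by (intro exI[of _ A] exI[of _ x] exI[of _ n]) simp
qed

section \<open>The two implications and the equivalence\<close>

text \<open>Supersolubility makes \<open>A\<close> finitely generated, and all its involutions equal
  one power of \<open>x\<close>, so \<open>abelian_subgroup_decomposition\<close> applies. The
  relation between \<open>d\<close> and \<open>x\<close> follows because \<open>d^(2^(h-1))\<close>
  is an involution of \<open>A\<close>.\<close>

lemma (in group) decomposition_if_self_centralizing:
  assumes nab: "\<not> comm_group G" and inf: "infinite (carrier G)" and sup: "supersoluble G"
    and P: "\<And>H. \<lbrakk>subgroup H G; \<not> comm_group (G\<lparr>carrier := H\<rparr>)\<rbrakk> \<Longrightarrow> centralizer G H \<subseteq> H"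
  shows "\<exists>A x as d (n :: nat) (h :: nat).
        x \<in> carrier G \<and> d \<in> carrier G \<and> set as \<subseteq> carrier G \<and>
        carrier G = A <#> generate G {x} \<and> ord x = 2 ^ n \<and>
        subgroup A G \<and> comm_group (G\<lparr>carrier := A\<rparr>) \<and> cyclic_direct_product G A (as @ [d]) \<and>
        (\<forall>a \<in> set as. ord a = 0 \<or> odd (ord a)) \<and> ord d = 2 ^ h \<and>
        (h > 0 \<longrightarrow> d [^] (2 ^ (h - 1) :: nat) = x [^] (2 ^ (n - 1) :: nat)) \<and>
        (\<forall>a \<in> A. conj G a x = inv a)"
proof -
  obtain N r where S: "supersoluble_series G N r" using supersoluble_imp_series[OF sup] by blast
  have "\<exists>A x n. x \<in> carrier G \<and> carrier G = A <#> generate G {x} \<and> ord x = 2 ^ n \<and> subgroup A G \<and>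
    comm_group (G\<lparr>carrier := A\<rparr>) \<and> (\<forall>a\<in>A. conj G a x = inv a) \<and>
    (\<forall>e\<in>A. e \<noteq> \<one> \<longrightarrow> e \<otimes> e = \<one> \<longrightarrow> e = x [^] (2 ^ (n - 1) :: nat))"
    by (rule inverting_structure_if_self_centralizing[OF nab inf S]) (rule P)
  then obtain A x n where x: "x \<in> carrier G" "carrier G = A <#> generate G {x}" "ord x = 2 ^ n"
    and A: "subgroup A G" "comm_group (G\<lparr>carrier := A\<rparr>)" and inverting: "\<forall>a\<in>A. conj G a x = inv a"
    and invol: "\<forall>e\<in>A. e \<noteq> \<one> \<longrightarrow> e \<otimes> e = \<one> \<longrightarrow> e = x [^] (2 ^ (n - 1) :: nat)" by blast
  obtain U where U: "finite U" "U \<subseteq> A" "A = generate G U" using finitely_generated_subgroup[OF S A(1)] by blast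
  have "\<exists>as d h. cyclic_direct_product G A (as @ [d]) \<and>
    (\<forall>a\<in>set as. ord a = 0 \<or> odd (ord a)) \<and> ord d = 2 ^ h"
    by (rule abelian_subgroup_decomposition[OF A U]) (use invol in metis)
  then obtain as d h where dec: "cyclic_direct_product G A (as @ [d])"
    "\<forall>a\<in>set as. ord a = 0 \<or> odd (ord a)" "ord d = 2 ^ h" by blast
  have asd: "set (as @ [d]) \<subseteq> carrier G" and A_eq: "A = generate G (set (as @ [d]))"
    using dec(1)[unfolded cyclic_direct_product_def, THEN conjunct1]
      dec(1)[unfolded cyclic_direct_product_def, THEN conjunct2, THEN conjunct1] by this+
  have dG: "d \<in> carrier G" using asd by simp
  have dA: "d \<in> A" unfolding A_eq by (simp add: generate.incl)
  have "d [^] (2 ^ (h - 1) :: nat) = x [^] (2 ^ (n - 1) :: nat)" if h: "h > 0"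
  proof -
    let ?e = "d [^] (2 ^ (h - 1) :: nat)"
    obtain k where k: "h = Suc k" using h by (cases h) auto
    have "?e \<noteq> \<one>" using pow_eq_id[OF dG, of "2 ^ k"] dec(3) k by (auto dest: dvd_imp_le)
    moreover have "?e \<otimes> ?e = \<one>"
      using pow_eq_id[OF dG, of "2 ^ k + 2 ^ k"] dec(3) k dG by (simp add: nat_pow_mult mult_2)
    moreover have "?e \<in> A" using subgroup_int_pow_closed[OF A(1) dA, of "int (2 ^ (h - 1))"] by (simp only: int_pow_int)
    ultimately show ?thesis using invol by blast
  qed
  moreover have "set as \<subseteq> carrier G" using asd by simp
  ultimately show ?thesis using x A inverting dec dG
    by (intro exI[of _ A] exI[of _ x] exI[of _ as] exI[of _ d] exI[of _ n] exI[of _ h]) simp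
qed

text \<open>An involution of \<open>A\<close> lies in \<open><d>\<close>, so it is
  \<open>d^(2^(h-1))\<close>, which the hypothesis identifies with a power of \<open>x\<close>. This
  is the assumption on involutions in \<open>self_centralizing_if_inverting\<close>.\<close>

lemma (in group) self_centralizing_if_decomposition:
  assumes x: "x \<in> carrier G" "d \<in> carrier G"
    and gen: "carrier G = A <#> generate G {x}" and ordx: "ord x = 2 ^ n"
    and A: "subgroup A G" "comm_group (G\<lparr>carrier := A\<rparr>)" and cdp: "cyclic_direct_product G A (as @ [d])"
    and odd: "\<forall>a\<in>set as. ord a = 0 \<or> odd (ord a)" and ordd: "ord d = 2 ^ h"
    and dx: "h > 0 \<longrightarrow> d [^] (2 ^ (h - 1) :: nat) = x [^] (2 ^ (n - 1) :: nat)"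
    and inverting: "\<forall>a\<in>A. conj G a x = inv a"
    and H: "subgroup H G" "\<not> comm_group (G\<lparr>carrier := H\<rparr>)"
  shows "centralizer G H \<subseteq> H"
proof -
  have invol: "c = x [^] (2 ^ (n - 1) :: nat)" if c: "c \<in> A" "c \<otimes> c = \<one>" "c \<noteq> \<one>" for c
  proof -
    have "c \<in> generate G {d}" by (rule involution_in_last_factor[OF cdp _ c(1,2)]) (use odd in blast)
    then obtain k :: int where "c = d [^] k" unfolding generate_pow[OF x(2)] by blast
    then show ?thesis using involution_in_cyclic_2_group[OF x(2) ordd, of k] c dx by simp
  qed
  have Acomm: "a \<otimes> b = b \<otimes> a" if "a \<in> A" "b \<in> A" for a b
    using comm_group_subgroup_iff[OF A(1)] A(2) that by blast
  show ?thesis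
    by (rule self_centralizing_if_inverting[OF x(1) ordx A(1) _ gen _ _ H])
      (use Acomm inverting invol in blast)+
qed

theorem theorem4p2:
  fixes G :: "('a, 'b) monoid_scheme"
  assumes "group G"
    and "\<not> comm_group G"
    and "infinite (carrier G)"
    and "supersoluble G"
  shows "(\<forall>H. subgroup H G \<and> \<not> comm_group (G\<lparr>carrier := H\<rparr>) \<longrightarrow> centralizer G H \<subseteq> H)
     \<longleftrightarrow>
     (\<exists>A x (as :: 'a list) d (n :: nat) (h :: nat).
        x \<in> carrier G \<and> d \<in> carrier G \<and> set as \<subseteq> carrier G \<and>
        carrier G = A <#>\<^bsub>G\<^esub> generate G {x} \<and>
        group.ord G x = 2 ^ n \<and>
        subgroup A G \<and> comm_group (G\<lparr>carrier := A\<rparr>) \<and>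
        cyclic_direct_product G A (as @ [d]) \<and>
        (\<forall>a \<in> set as. group.ord G a = 0 \<or> odd (group.ord G a)) \<and>
        group.ord G d = 2 ^ h \<and>
        (h > 0 \<longrightarrow> d [^]\<^bsub>G\<^esub> (2 ^ (h - 1) :: nat) = x [^]\<^bsub>G\<^esub> (2 ^ (n - 1) :: nat)) \<and>
        (\<forall>a \<in> A. conj G a x = inv\<^bsub>G\<^esub> a))"
  (is "?L \<longleftrightarrow> ?R")
proof
  assume L: ?L
  show ?R
    by (rule group.decomposition_if_self_centralizing[OF assms]) (use L in blast)
next
  assume ?R
  then show ?L
    by (elim exE conjE, intro allI impI, elim conjE) (rule group.self_centralizing_if_decomposition[OF assms(1)])
qed

end
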